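(* Let $\lambda$ be the flat distributive law of the presheaf 2-monad $\mathbb{P}$ over itself given by $\lambda_X=\mathsf{y}_{\mathsf{P}X}\cdot\sup_{\mathsf{P}X}:\mathsf{P}\mathsf{P}X\to\mathsf{P}\mathsf{P}X$. Then there is an isomorphism of 2-categories $$(\lambda,\mathcal{Q})\text{-}\mathbf{Alg}\cong\mathcal{Q}\text{-}\mathbf{Cls}$$ between lax $\lambda$-algebras over $\mathcal{Q}$ and $\mathcal{Q}$-closure spaces.
   Context: Basic conventions. $\mathcal{Q}$ is a small quantaloid: a small category whose hom-sets are complete lattices (order $\preceq$) and whose composition preserves arbitrary suprema in each variable; $\mathcal{Q}_0$ is its object set. For $u:r\to s$, $v:s\to t$, $w:r\to t$ in $\mathcal{Q}$, the arrows $v\searrow w:r\to s$ and $w\swarrow u:s\to t$ are defined by $u\preceq v\searrow w\iff v\circ u\preceq w\iff v\preceq w\swarrow u$. For sets $X,Y$ equipped with type maps $|\text{-}|$ to $\mathcal{Q}_0$, a $\mathcal{Q}$-relation $\phi:X\nrightarrow Y$ assigns to each $(x,y)$ a morphism $\phi(x,y):|x|\to|y|$ of $\mathcal{Q}$; these are ordered pointwise by $\preceq$ and composed by $(\psi\circ\phi)(x,z)=\bigvee_y\psi(y,z)\circ\phi(x,y)$. A $\mathcal{Q}$-category is a set $X$ over $\mathcal{Q}_0$ with a $\mathcal{Q}$-relation $1_X^*:X\nrightarrow X$ (its hom) such that $1_{|x|}\preceq 1_X^*(x,x)$ and $1_X^*\circ 1_X^*\preceq 1_X^*$; it is preordered by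 $x\leq x'\iff |x|=|x'|$ and $1_{|x|}\preceq 1_X^*(x,x')$. A $\mathcal{Q}$-functor $f:X\to Y$ is a type-preserving map with $1_X^*(x,x')\preceq 1_Y^*(fx,fx')$; $f\leq g$ is pointwise. This gives the locally preordered 2-category $\mathcal{Q}\text{-}\mathbf{Cat}$. A 2-functor on it is a functor that is monotone on homs; a 2-monad $(T,m,e)$ is a monad whose functor $T$ is a 2-functor (multiplication $m:TT\to T$, unit $e:1\to T$). A distributor $\phi:X\nrightarrow Y$ is a $\mathcal{Q}$-relation with $1_Y^*\circ\phi\circ 1_X^*\preceq\phi$. For a $\mathcal{Q}$-functor $f:X\to Y$: $f_*:X\nrightarrow Y$, $f_*(x,y)=1_Y^*(fx,y)$, and $f^*:Y\nrightarrow X$, $f^*(y,x)=1_Y^*(y,fx)$. $\mathsf{P}X$ is the $\mathcal{Q}$-category of distributors $\sigma:X\nrightarrow\{s\}$ ($s\in\mathcal{Q}_0$, $|\sigma|=s$, $\{s\}$ the one-object $\mathcal{Q}$-category of type $s$ with hom $1_s$) with $1_{\mathsf{P}X}^*(\sigma,\sigma')=\bigwedge_x\sigma'(x)\swarrow\sigma(x)$. The Yoneda embedding is $\mathsf{y}_X:X\to\mathsf{P}X$, $x\mapsto 1_X^*(-,x)$. For $f:X\to Y$: $f_!:\mathsf{P}X\to\mathsf{P}Y$, $\sigma\mapsto\sigma\circ f^*$, and $f^!:\mathsf{P}Y\to\mathsf{P}X$, $\sigma\mapsto\sigma\circ f_*$. The presheaf 2-monad $\mathbb{P}=(\mathsf{P},\mathsf{s},\mathsf{y})$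 sends $f$ to $f_!$, has unit $\mathsf{y}$ and multiplication $\mathsf{s}_X=\sup_{\mathsf{P}X}=\mathsf{y}_X^!:\mathsf{P}\mathsf{P}X\to\mathsf{P}X$, where $\sup_{\mathsf{P}X}$ is the left adjoint of $\mathsf{y}_{\mathsf{P}X}$. Distributive laws ("distributive law" means lax distributive law). For a 2-monad $\mathbb{T}=(T,m,e)$ on $\mathcal{Q}\text{-}\mathbf{Cat}$, a distributive law $\lambda:T\mathsf{P}\to\mathsf{P}T$ of $\mathbb{T}$ over $\mathbb{P}$ is a family of $\mathcal{Q}$-functors $\lambda_X:T\mathsf{P}X\to\mathsf{P}TX$ such that for all $\mathcal{Q}$-functors $f:X\to Y$: (a) $(Tf)_!\cdot\lambda_X\leq\lambda_Y\cdot T(f_!)$; (b) $\mathsf{y}_{TX}\leq\lambda_X\cdot T\mathsf{y}_X$; (c) $\mathsf{s}_{TX}\cdot(\lambda_X)_!\cdot\lambda_{\mathsf{P}X}\leq\lambda_X\cdot T\mathsf{s}_X$; (d) $(e_X)_!\leq\lambda_X\cdot e_{\mathsf{P}X}$; (e) $(m_X)_!\cdot\lambda_{TX}\cdot T\lambda_X\leq\lambda_X\cdot m_{\mathsf{P}X}$. It is flat if (b) is an equality for all $X$. Lax algebras. For a distributive law $\lambda$ of $\mathbb{T}$ over $\mathbb{P}$, a lax $\lambda$-algebra $(X,p)$ over $\mathcal{Q}$ is a $\mathcal{Q}$-category $X$ with a $\mathcal{Q}$-functor $p:TX\to\mathsf{P}X$ such that $\mathsf{y}_X\leq p\cdot e_X$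 and $\mathsf{s}_X\cdot p_!\cdot\lambda_X\cdot Tp\leq p\cdot m_X$. A lax $\lambda$-homomorphism $f:(X,p)\to(Y,q)$ is a $\mathcal{Q}$-functor $f:X\to Y$ with $f_!\cdot p\leq q\cdot Tf$. With the local order of $\mathcal{Q}\text{-}\mathbf{Cat}$ these form the 2-category $(\lambda,\mathcal{Q})\text{-}\mathbf{Alg}$. (Here $\mathbb{T}=\mathbb{P}$.) $\mathcal{Q}$-closure spaces. A $\mathcal{Q}$-closure space $(X,c)$ is a $\mathcal{Q}$-category $X$ with a $\mathcal{Q}$-functor $c:\mathsf{P}X\to\mathsf{P}X$ satisfying $1_{\mathsf{P}X}\leq c$ and $c\cdot c=c$. A continuous $\mathcal{Q}$-functor $f:(X,c)\to(Y,d)$ is a $\mathcal{Q}$-functor $f:X\to Y$ with $f_!\cdot c\leq d\cdot f_!$. With the local order of $\mathcal{Q}\text{-}\mathbf{Cat}$ these form the 2-category $\mathcal{Q}\text{-}\mathbf{Cls}$. *)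

theory Defs
  imports "HOL-Algebra.Complete_Lattice"
begin

section \<open>Quantaloids\<close>

record ('o, 'a) quantaloid =
  obj :: "'o set"
  arr :: "'a set"
  src :: "'a \<Rightarrow> 'o"
  tgt :: "'a \<Rightarrow> 'o"
  ide :: "'o \<Rightarrow> 'a"
  cmp :: "'a \<Rightarrow> 'a \<Rightarrow> 'a" (infixl "\<cdot>\<index>" 70)
  leq :: "'a \<Rightarrow> 'a \<Rightarrow> bool" (infix "\<preceq>\<index>" 50)

text \<open>
  Composition is written in applicative order: \<open>v \<cdot>\<^bsub>Q\<^esub> u\<close> is \<open>v\<close> after \<open>u\<close>.  The relation \<open>leq\<close>
  is only meaningful between parallel arrows.
\<close>

definition hom :: "('o, 'a) quantaloid \<Rightarrow> 'o \<Rightarrow> 'o \<Rightarrow> 'a gorder" where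
  "hom Q r s = \<lparr>carrier = {u \<in> arr Q. src Q u = r \<and> tgt Q u = s}, eq = (=), le = leq Q\<rparr>"

abbreviation arrs :: "('o, 'a) quantaloid \<Rightarrow> 'o \<Rightarrow> 'o \<Rightarrow> 'a set" where
  "arrs Q r s \<equiv> carrier (hom Q r s)"

definition quantaloid :: "('o, 'a) quantaloid \<Rightarrow> bool" where
  "quantaloid Q \<longleftrightarrow>
     (\<forall>u \<in> arr Q. src Q u \<in> obj Q \<and> tgt Q u \<in> obj Q) \<and>
     (\<forall>r \<in> obj Q. ide Q r \<in> arrs Q r r) \<and>
     (\<forall>r \<in> obj Q. \<forall>s \<in> obj Q. \<forall>t \<in> obj Q. \<forall>u \<in> arrs Q r s. \<forall>v \<in> arrs Q s t.
        v \<cdot>\<^bsub>Q\<^esub> u \<in> arrs Q r t) \<and>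
     (\<forall>r \<in> obj Q. \<forall>s \<in> obj Q. \<forall>u \<in> arrs Q r s. u \<cdot>\<^bsub>Q\<^esub> ide Q r = u \<and> ide Q s \<cdot>\<^bsub>Q\<^esub> u = u) \<and>
     (\<forall>q \<in> obj Q. \<forall>r \<in> obj Q. \<forall>s \<in> obj Q. \<forall>t \<in> obj Q.
        \<forall>u \<in> arrs Q q r. \<forall>v \<in> arrs Q r s. \<forall>w \<in> arrs Q s t.
          w \<cdot>\<^bsub>Q\<^esub> v \<cdot>\<^bsub>Q\<^esub> u = w \<cdot>\<^bsub>Q\<^esub> (v \<cdot>\<^bsub>Q\<^esub> u)) \<and>
     (\<forall>r \<in> obj Q. \<forall>s \<in> obj Q. complete_lattice (hom Q r s)) \<and>
     (\<forall>r \<in> obj Q. \<forall>s \<in> obj Q. \<forall>t \<in> obj Q. \<forall>u \<in> arrs Q r s. \<forall>A \<subseteq> arrs Q s t.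
        (\<Squnion>\<^bsub>hom Q s t\<^esub> A) \<cdot>\<^bsub>Q\<^esub> u = \<Squnion>\<^bsub>hom Q r t\<^esub> ((\<lambda>v. v \<cdot>\<^bsub>Q\<^esub> u) ` A)) \<and>
     (\<forall>r \<in> obj Q. \<forall>s \<in> obj Q. \<forall>t \<in> obj Q. \<forall>v \<in> arrs Q s t. \<forall>A \<subseteq> arrs Q r s.
        v \<cdot>\<^bsub>Q\<^esub> (\<Squnion>\<^bsub>hom Q r s\<^esub> A) = \<Squnion>\<^bsub>hom Q r t\<^esub> ((\<lambda>u. v \<cdot>\<^bsub>Q\<^esub> u) ` A))"

text \<open>\<open>residual Q w u\<close> is the arrow \<open>w \<swarrow> u : s \<rightarrow> t\<close> for \<open>u : r \<rightarrow> s\<close> and \<open>w : r \<rightarrow> t\<close>.\<close>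

definition residual :: "('o, 'a) quantaloid \<Rightarrow> 'a \<Rightarrow> 'a \<Rightarrow> 'a" where
  "residual Q w u = (THE x. x \<in> arrs Q (tgt Q u) (tgt Q w) \<and>
     (\<forall>v \<in> arrs Q (tgt Q u) (tgt Q w). v \<cdot>\<^bsub>Q\<^esub> u \<preceq>\<^bsub>Q\<^esub> w \<longleftrightarrow> v \<preceq>\<^bsub>Q\<^esub> x))"


section \<open>Relations, categories, functors and distributors over a quantaloid\<close>

text \<open>
  All structure maps are required to be \<open>undefined\<close> outside their carriers, so that HOL equality
  is equality of the mathematical objects.
\<close>

record ('o, 'x) qset = "'x partial_object" +
  etype :: "'x \<Rightarrow> 'o"

record ('o, 'a, 'x) qcat = "('o, 'x) qset" +
  chom :: "'x \<Rightarrow> 'x \<Rightarrow> 'a"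

definition qrel ::
  "('o, 'a) quantaloid \<Rightarrow> ('o, 'x, 'm) qset_scheme \<Rightarrow> ('o, 'y, 'n) qset_scheme \<Rightarrow> ('x \<Rightarrow> 'y \<Rightarrow> 'a) set"
where
  "qrel Q X Y = {\<phi>.
     (\<forall>x \<in> carrier X. \<forall>y \<in> carrier Y. \<phi> x y \<in> arrs Q (etype X x) (etype Y y)) \<and>
     (\<forall>x y. \<not> (x \<in> carrier X \<and> y \<in> carrier Y) \<longrightarrow> \<phi> x y = undefined)}"

definition rel_le ::
  "('o, 'a) quantaloid \<Rightarrow> ('o, 'x, 'm) qset_scheme \<Rightarrow> ('o, 'y, 'n) qset_scheme \<Rightarrow>
   ('x \<Rightarrow> 'y \<Rightarrow> 'a) \<Rightarrow> ('x \<Rightarrow> 'y \<Rightarrow> 'a) \<Rightarrow> bool"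
where
  "rel_le Q X Y \<phi> \<psi> \<longleftrightarrow> (\<forall>x \<in> carrier X. \<forall>y \<in> carrier Y. \<phi> x y \<preceq>\<^bsub>Q\<^esub> \<psi> x y)"

text \<open>\<open>rel_comp Q X Y Z \<psi> \<phi>\<close> is \<open>\<psi> \<circ> \<phi>\<close> for relations \<open>\<phi>\<close> from \<open>X\<close> to \<open>Y\<close> and \<open>\<psi>\<close> from \<open>Y\<close> to \<open>Z\<close>.\<close>

definition rel_comp ::
  "('o, 'a) quantaloid \<Rightarrow> ('o, 'x, 'm) qset_scheme \<Rightarrow> ('o, 'y, 'n) qset_scheme \<Rightarrow>
   ('o, 'z, 'k) qset_scheme \<Rightarrow> ('y \<Rightarrow> 'z \<Rightarrow> 'a) \<Rightarrow> ('x \<Rightarrow> 'y \<Rightarrow> 'a) \<Rightarrow> 'x \<Rightarrow> 'z \<Rightarrow> 'a"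
where
  "rel_comp Q X Y Z \<psi> \<phi> = (\<lambda>x z.
     if x \<in> carrier X \<and> z \<in> carrier Z
     then \<Squnion>\<^bsub>hom Q (etype X x) (etype Z z)\<^esub> ((\<lambda>y. \<psi> y z \<cdot>\<^bsub>Q\<^esub> \<phi> x y) ` carrier Y)
     else undefined)"

definition qcategory :: "('o, 'a) quantaloid \<Rightarrow> ('o, 'a, 'x) qcat \<Rightarrow> bool" where
  "qcategory Q X \<longleftrightarrow>
     etype X \<in> carrier X \<rightarrow>\<^sub>E obj Q \<and>
     chom X \<in> qrel Q X X \<and>
     (\<forall>x \<in> carrier X. ide Q (etype X x) \<preceq>\<^bsub>Q\<^esub> chom X x x) \<and>
     rel_le Q X X (rel_comp Q X X X (chom X) (chom X)) (chom X)"

definition cat_le :: "('o, 'a) quantaloid \<Rightarrow> ('o, 'a, 'x) qcat \<Rightarrow> 'x \<Rightarrow> 'x \<Rightarrow> bool" where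
  "cat_le Q X x x' \<longleftrightarrow> etype X x = etype X x' \<and> ide Q (etype X x) \<preceq>\<^bsub>Q\<^esub> chom X x x'"

definition qfunctors ::
  "('o, 'a) quantaloid \<Rightarrow> ('o, 'a, 'x) qcat \<Rightarrow> ('o, 'a, 'y) qcat \<Rightarrow> ('x \<Rightarrow> 'y) set"
where
  "qfunctors Q X Y = {f \<in> carrier X \<rightarrow>\<^sub>E carrier Y.
     (\<forall>x \<in> carrier X. etype Y (f x) = etype X x) \<and>
     (\<forall>x \<in> carrier X. \<forall>x' \<in> carrier X. chom X x x' \<preceq>\<^bsub>Q\<^esub> chom Y (f x) (f x'))}"

definition fun_le ::
  "('o, 'a) quantaloid \<Rightarrow> ('o, 'a, 'x) qcat \<Rightarrow> ('o, 'a, 'y) qcat \<Rightarrow> ('x \<Rightarrow> 'y) \<Rightarrow> ('x \<Rightarrow> 'y) \<Rightarrow> bool"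
where
  "fun_le Q X Y f g \<longleftrightarrow> (\<forall>x \<in> carrier X. cat_le Q Y (f x) (g x))"

definition id_functor :: "('o, 'a, 'x) qcat \<Rightarrow> 'x \<Rightarrow> 'x" where
  "id_functor X = (\<lambda>x \<in> carrier X. x)"

definition left_adjoint ::
  "('o, 'a) quantaloid \<Rightarrow> ('o, 'a, 'x) qcat \<Rightarrow> ('o, 'a, 'y) qcat \<Rightarrow> ('x \<Rightarrow> 'y) \<Rightarrow> ('y \<Rightarrow> 'x) \<Rightarrow> bool"
where
  "left_adjoint Q X Y f g \<longleftrightarrow>
     f \<in> qfunctors Q X Y \<and> g \<in> qfunctors Q Y X \<and>
     fun_le Q X X (id_functor X) (compose (carrier X) g f) \<and>
     fun_le Q Y Y (compose (carrier Y) f g) (id_functor Y)"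

definition distributors ::
  "('o, 'a) quantaloid \<Rightarrow> ('o, 'a, 'x) qcat \<Rightarrow> ('o, 'a, 'y) qcat \<Rightarrow> ('x \<Rightarrow> 'y \<Rightarrow> 'a) set"
where
  "distributors Q X Y = {\<phi> \<in> qrel Q X Y.
     rel_le Q X Y (rel_comp Q X Y Y (chom Y) (rel_comp Q X X Y \<phi> (chom X))) \<phi>}"

definition graph :: "('o, 'a, 'x) qcat \<Rightarrow> ('o, 'a, 'y) qcat \<Rightarrow> ('x \<Rightarrow> 'y) \<Rightarrow> 'x \<Rightarrow> 'y \<Rightarrow> 'a" where
  "graph X Y f = (\<lambda>x y. if x \<in> carrier X \<and> y \<in> carrier Y then chom Y (f x) y else undefined)"

definition cograph :: "('o, 'a, 'x) qcat \<Rightarrow> ('o, 'a, 'y) qcat \<Rightarrow> ('x \<Rightarrow> 'y) \<Rightarrow> 'y \<Rightarrow> 'x \<Rightarrow> 'a" where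
  "cograph X Y f = (\<lambda>y x. if x \<in> carrier X \<and> y \<in> carrier Y then chom Y y (f x) else undefined)"


section \<open>The presheaf 2-monad\<close>

definition one_object :: "('o, 'a) quantaloid \<Rightarrow> 'o \<Rightarrow> ('o, 'a, unit) qcat" where
  "one_object Q s = \<lparr>carrier = UNIV, etype = (\<lambda>_. s), chom = (\<lambda>_ _. ide Q s)\<rparr>"

text \<open>
  An element of the presheaf category is a distributor into a one-object category together with
  the type of that object (which the underlying function does not determine if \<open>X\<close> is empty).
\<close>

type_synonym ('o, 'a, 'x) presheaf = "'o \<times> ('x \<Rightarrow> unit \<Rightarrow> 'a)"
type_synonym ('o, 'a, 'x) presheaf2 = "('o, 'a, ('o, 'a, 'x) presheaf) presheaf"

definition psh :: "('o, 'a) quantaloid \<Rightarrow> ('o, 'a, 'x) qcat \<Rightarrow> ('o, 'a, ('o, 'a, 'x) presheaf) qcat"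
where
  "psh Q X = (let P = (SIGMA s : obj Q. distributors Q X (one_object Q s)) in
     \<lparr>carrier = P,
      etype = (\<lambda>(s, \<sigma>) \<in> P. s),
      chom = (\<lambda>\<sigma> \<sigma>'. if \<sigma> \<in> P \<and> \<sigma>' \<in> P
        then \<Sqinter>\<^bsub>hom Q (fst \<sigma>) (fst \<sigma>')\<^esub> ((\<lambda>x. residual Q (snd \<sigma>' x ()) (snd \<sigma> x ())) ` carrier X)
        else undefined)\<rparr>)"

definition yoneda :: "('o, 'a) quantaloid \<Rightarrow> ('o, 'a, 'x) qcat \<Rightarrow> 'x \<Rightarrow> ('o, 'a, 'x) presheaf" where
  "yoneda Q X = (\<lambda>x \<in> carrier X. (etype X x, \<lambda>z _. chom X z x))"

text \<open>\<open>direct_image Q X Y f\<close> and \<open>inverse_image Q X Y f\<close> are \<open>f\<^sub>!\<close> and \<open>f\<^sup>!\<close> for \<open>f : X \<rightarrow> Y\<close>.\<close>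

definition direct_image ::
  "('o, 'a) quantaloid \<Rightarrow> ('o, 'a, 'x) qcat \<Rightarrow> ('o, 'a, 'y) qcat \<Rightarrow> ('x \<Rightarrow> 'y) \<Rightarrow>
   ('o, 'a, 'x) presheaf \<Rightarrow> ('o, 'a, 'y) presheaf"
where
  "direct_image Q X Y f = (\<lambda>(s, \<sigma>) \<in> carrier (psh Q X).
     (s, rel_comp Q Y X (one_object Q s) \<sigma> (cograph X Y f)))"

definition inverse_image ::
  "('o, 'a) quantaloid \<Rightarrow> ('o, 'a, 'x) qcat \<Rightarrow> ('o, 'a, 'y) qcat \<Rightarrow> ('x \<Rightarrow> 'y) \<Rightarrow>
   ('o, 'a, 'y) presheaf \<Rightarrow> ('o, 'a, 'x) presheaf"
where
  "inverse_image Q X Y f = (\<lambda>(s, \<sigma>) \<in> carrier (psh Q Y).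
     (s, rel_comp Q X Y (one_object Q s) \<sigma> (graph X Y f)))"

definition psh_mult ::
  "('o, 'a) quantaloid \<Rightarrow> ('o, 'a, 'x) qcat \<Rightarrow> ('o, 'a, 'x) presheaf2 \<Rightarrow> ('o, 'a, 'x) presheaf"
where
  "psh_mult Q X = inverse_image Q X (psh Q X) (yoneda Q X)"

text \<open>
  \<open>sup_functor Q X\<close> is meaningful if \<open>X\<close> is cocomplete and separated, which presheaf categories are.
\<close>

definition sup_functor ::
  "('o, 'a) quantaloid \<Rightarrow> ('o, 'a, 'x) qcat \<Rightarrow> ('o, 'a, 'x) presheaf \<Rightarrow> 'x"
where
  "sup_functor Q X = (THE f. left_adjoint Q (psh Q X) X f (yoneda Q X))"


section \<open>Lax distributive laws of the presheaf 2-monad over itself\<close>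

text \<open>
  A family indexed by all categories ranges over all carrier types, which is not expressible by a
  single HOL function.  The predicates below therefore take the instances of the family that their
  conditions mention: \<open>L\<close> and \<open>L'\<close> at two arbitrary carrier types, and \<open>LP\<close> at the type of
  presheaves over the first one.  A (type-polymorphic) family is a law if this holds at all types.
\<close>

type_synonym ('o, 'a, 'x) law = "('o, 'a, 'x) qcat \<Rightarrow> ('o, 'a, 'x) presheaf2 \<Rightarrow> ('o, 'a, 'x) presheaf2"

definition law_components :: "('o, 'a) quantaloid \<Rightarrow> ('o, 'a, 'x) law \<Rightarrow> bool" where
  "law_components Q L \<longleftrightarrow>
     (\<forall>X. qcategory Q X \<longrightarrow> L X \<in> qfunctors Q (psh Q (psh Q X)) (psh Q (psh Q X)))"

definition distributive_law ::
  "('o, 'a) quantaloid \<Rightarrow> ('o, 'a, 'x) law \<Rightarrow> ('o, 'a, 'y) law \<Rightarrow>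
   ('o, 'a, ('o, 'a, 'x) presheaf) law \<Rightarrow> bool"
where
  "distributive_law Q L L' LP \<longleftrightarrow>
     law_components Q L \<and> law_components Q L' \<and> law_components Q LP \<and>
     (\<forall>X Y f. qcategory Q X \<longrightarrow> qcategory Q Y \<longrightarrow> f \<in> qfunctors Q X Y \<longrightarrow>
       (let PX = psh Q X; PPX = psh Q PX; PY = psh Q Y; PPY = psh Q PY;
            Pf = direct_image Q X Y f; PPf = direct_image Q PX PY Pf
        in fun_le Q PPX PPY (compose (carrier PPX) PPf (L X)) (compose (carrier PPX) (L' Y) PPf))) \<and>
     (\<forall>X. qcategory Q X \<longrightarrow>
       (let PX = psh Q X; PPX = psh Q PX; PPPX = psh Q PPX
        in fun_le Q PX PPX
             (yoneda Q PX)
             (compose (carrier PX) (L X) (direct_image Q X PX (yoneda Q X))) \<and>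
           fun_le Q PPPX PPX
             (compose (carrier PPPX) (psh_mult Q PX)
               (compose (carrier PPPX) (direct_image Q PPX PPX (L X)) (LP PX)))
             (compose (carrier PPPX) (L X) (direct_image Q PPX PX (psh_mult Q X))) \<and>
           fun_le Q PX PPX
             (direct_image Q X PX (yoneda Q X))
             (compose (carrier PX) (L X) (yoneda Q PX)) \<and>
           fun_le Q PPPX PPX
             (compose (carrier PPPX) (direct_image Q PPX PX (psh_mult Q X))
               (compose (carrier PPPX) (LP PX) (direct_image Q PPX PPX (L X))))
             (compose (carrier PPPX) (L X) (psh_mult Q PX))))"

definition flat_law :: "('o, 'a) quantaloid \<Rightarrow> ('o, 'a, 'x) law \<Rightarrow> bool" where
  "flat_law Q L \<longleftrightarrow> (\<forall>X. qcategory Q X \<longrightarrow>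
     yoneda Q (psh Q X) =
       compose (carrier (psh Q X)) (L X) (direct_image Q X (psh Q X) (yoneda Q X)))"

definition yoneda_sup_law :: "('o, 'a) quantaloid \<Rightarrow> ('o, 'a, 'x) law" where
  "yoneda_sup_law Q X =
     compose (carrier (psh Q (psh Q X))) (yoneda Q (psh Q X)) (sup_functor Q (psh Q X))"


section \<open>Locally preordered 2-categories\<close>

record ('c, 'm) twocat =
  ob :: "'c set"
  mor :: "'c \<Rightarrow> 'c \<Rightarrow> 'm set"
  unit_mor :: "'c \<Rightarrow> 'm"
  comp_mor :: "'c \<Rightarrow> 'c \<Rightarrow> 'c \<Rightarrow> 'm \<Rightarrow> 'm \<Rightarrow> 'm"
  le_mor :: "'c \<Rightarrow> 'c \<Rightarrow> 'm \<Rightarrow> 'm \<Rightarrow> bool"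

text \<open>\<open>comp_mor C A B D g f\<close> is \<open>g\<close> after \<open>f\<close> for \<open>f : A \<rightarrow> B\<close> and \<open>g : B \<rightarrow> D\<close>.\<close>

definition two_category :: "('c, 'm) twocat \<Rightarrow> bool" where
  "two_category C \<longleftrightarrow>
     (\<forall>A \<in> ob C. unit_mor C A \<in> mor C A A) \<and>
     (\<forall>A \<in> ob C. \<forall>B \<in> ob C. \<forall>D \<in> ob C. \<forall>f \<in> mor C A B. \<forall>g \<in> mor C B D.
        comp_mor C A B D g f \<in> mor C A D) \<and>
     (\<forall>A \<in> ob C. \<forall>B \<in> ob C. \<forall>f \<in> mor C A B.
        comp_mor C A A B f (unit_mor C A) = f \<and> comp_mor C A B B (unit_mor C B) f = f) \<and>
     (\<forall>A \<in> ob C. \<forall>B \<in> ob C. \<forall>D \<in> ob C. \<forall>E \<in> ob C.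
        \<forall>f \<in> mor C A B. \<forall>g \<in> mor C B D. \<forall>h \<in> mor C D E.
          comp_mor C A B E (comp_mor C B D E h g) f = comp_mor C A D E h (comp_mor C A B D g f)) \<and>
     (\<forall>A \<in> ob C. \<forall>B \<in> ob C. \<forall>f \<in> mor C A B. le_mor C A B f f) \<and>
     (\<forall>A \<in> ob C. \<forall>B \<in> ob C. \<forall>f \<in> mor C A B. \<forall>g \<in> mor C A B. \<forall>h \<in> mor C A B.
        le_mor C A B f g \<longrightarrow> le_mor C A B g h \<longrightarrow> le_mor C A B f h) \<and>
     (\<forall>A \<in> ob C. \<forall>B \<in> ob C. \<forall>D \<in> ob C.
        \<forall>f \<in> mor C A B. \<forall>f' \<in> mor C A B. \<forall>g \<in> mor C B D. \<forall>g' \<in> mor C B D.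
          le_mor C A B f f' \<longrightarrow> le_mor C B D g g' \<longrightarrow>
          le_mor C A D (comp_mor C A B D g f) (comp_mor C A B D g' f'))"

definition two_functor ::
  "('c, 'm) twocat \<Rightarrow> ('d, 'n) twocat \<Rightarrow> ('c \<Rightarrow> 'd) \<Rightarrow> ('c \<Rightarrow> 'c \<Rightarrow> 'm \<Rightarrow> 'n) \<Rightarrow> bool"
where
  "two_functor C D F0 F1 \<longleftrightarrow>
     (\<forall>A \<in> ob C. F0 A \<in> ob D) \<and>
     (\<forall>A \<in> ob C. \<forall>B \<in> ob C. \<forall>f \<in> mor C A B. F1 A B f \<in> mor D (F0 A) (F0 B)) \<and>
     (\<forall>A \<in> ob C. F1 A A (unit_mor C A) = unit_mor D (F0 A)) \<and>
     (\<forall>A \<in> ob C. \<forall>B \<in> ob C. \<forall>E \<in> ob C. \<forall>f \<in> mor C A B. \<forall>g \<in> mor C B E.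
        F1 A E (comp_mor C A B E g f) =
        comp_mor D (F0 A) (F0 B) (F0 E) (F1 B E g) (F1 A B f)) \<and>
     (\<forall>A \<in> ob C. \<forall>B \<in> ob C. \<forall>f \<in> mor C A B. \<forall>g \<in> mor C A B.
        le_mor C A B f g \<longrightarrow> le_mor D (F0 A) (F0 B) (F1 A B f) (F1 A B g))"

definition inverse_functors ::
  "('c, 'm) twocat \<Rightarrow> ('c \<Rightarrow> 'd) \<Rightarrow> ('c \<Rightarrow> 'c \<Rightarrow> 'm \<Rightarrow> 'n) \<Rightarrow>
   ('d \<Rightarrow> 'c) \<Rightarrow> ('d \<Rightarrow> 'd \<Rightarrow> 'n \<Rightarrow> 'm) \<Rightarrow> bool"
where
  "inverse_functors C F0 F1 G0 G1 \<longleftrightarrow>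
     (\<forall>A \<in> ob C. G0 (F0 A) = A) \<and>
     (\<forall>A \<in> ob C. \<forall>B \<in> ob C. \<forall>f \<in> mor C A B. G1 (F0 A) (F0 B) (F1 A B f) = f)"

definition isomorphic_two_categories :: "('c, 'm) twocat \<Rightarrow> ('d, 'n) twocat \<Rightarrow> bool" where
  "isomorphic_two_categories C D \<longleftrightarrow>
     two_category C \<and> two_category D \<and>
     (\<exists>F0 F1 G0 G1. two_functor C D F0 F1 \<and> two_functor D C G0 G1 \<and>
        inverse_functors C F0 F1 G0 G1 \<and> inverse_functors D G0 G1 F0 F1)"


section \<open>Lax algebras and closure spaces\<close>

text \<open>Both kinds of objects are pairs of a category \<open>X\<close> and an endofunctor of its presheaf category.\<close>

type_synonym ('o, 'a, 'x) space =
  "('o, 'a, 'x) qcat \<times> (('o, 'a, 'x) presheaf \<Rightarrow> ('o, 'a, 'x) presheaf)"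

definition lax_algebra :: "('o, 'a) quantaloid \<Rightarrow> ('o, 'a, 'x) law \<Rightarrow> ('o, 'a, 'x) space \<Rightarrow> bool" where
  "lax_algebra Q L = (\<lambda>(X, p). let PX = psh Q X; PPX = psh Q PX in
     qcategory Q X \<and>
     p \<in> qfunctors Q PX PX \<and>
     fun_le Q X PX (yoneda Q X) (compose (carrier X) p (yoneda Q X)) \<and>
     fun_le Q PPX PX
       (compose (carrier PPX) (psh_mult Q X)
         (compose (carrier PPX) (direct_image Q PX PX p)
           (compose (carrier PPX) (L X) (direct_image Q PX PX p))))
       (compose (carrier PPX) p (psh_mult Q X)))"

definition closure_space :: "('o, 'a) quantaloid \<Rightarrow> ('o, 'a, 'x) space \<Rightarrow> bool" where
  "closure_space Q = (\<lambda>(X, c). let PX = psh Q X in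
     qcategory Q X \<and>
     c \<in> qfunctors Q PX PX \<and>
     fun_le Q PX PX (id_functor PX) c \<and>
     compose (carrier PX) c c = c)"

definition lax_homs :: "('o, 'a) quantaloid \<Rightarrow> ('o, 'a, 'x) space \<Rightarrow> ('o, 'a, 'x) space \<Rightarrow> ('x \<Rightarrow> 'x) set"
where
  "lax_homs Q = (\<lambda>(X, p) (Y, q). {f \<in> qfunctors Q X Y.
     fun_le Q (psh Q X) (psh Q Y)
       (compose (carrier (psh Q X)) (direct_image Q X Y f) p)
       (compose (carrier (psh Q X)) q (direct_image Q X Y f))})"

definition continuous_functors ::
  "('o, 'a) quantaloid \<Rightarrow> ('o, 'a, 'x) space \<Rightarrow> ('o, 'a, 'x) space \<Rightarrow> ('x \<Rightarrow> 'x) set"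
where
  "continuous_functors Q = (\<lambda>(X, c) (Y, d). {f \<in> qfunctors Q X Y.
     fun_le Q (psh Q X) (psh Q Y)
       (compose (carrier (psh Q X)) (direct_image Q X Y f) c)
       (compose (carrier (psh Q X)) d (direct_image Q X Y f))})"

definition Alg :: "('o, 'a) quantaloid \<Rightarrow> ('o, 'a, 'x) law \<Rightarrow> (('o, 'a, 'x) space, 'x \<Rightarrow> 'x) twocat" where
  "Alg Q L =
     \<lparr>ob = {A. lax_algebra Q L A},
      mor = lax_homs Q,
      unit_mor = (\<lambda>A. id_functor (fst A)),
      comp_mor = (\<lambda>A B C g f. compose (carrier (fst A)) g f),
      le_mor = (\<lambda>A B. fun_le Q (fst A) (fst B))\<rparr>"

definition Cls :: "('o, 'a) quantaloid \<Rightarrow> (('o, 'a, 'x) space, 'x \<Rightarrow> 'x) twocat" where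
  "Cls Q =
     \<lparr>ob = {A. closure_space Q A},
      mor = continuous_functors Q,
      unit_mor = (\<lambda>A. id_functor (fst A)),
      comp_mor = (\<lambda>A B C g f. compose (carrier (fst A)) g f),
      le_mor = (\<lambda>A B. fun_le Q (fst A) (fst B))\<rparr>"

end

theory Submission
  imports Defs
begin

text \<open>
  Write \<open>P\<close> for the presheaf construction, \<open>y\<close> for the Yoneda embedding and \<open>s\<close> for the
  multiplication \<open>y\<^sup>!\<close>.  Presheaves form a separated category, so a presheaf is determined by its
  upper bounds, and an equation between composites of left adjoints follows from the equation
  between their right adjoints.  Two adjunctions, both as equalities of homs, therefore carry the
  whole theory of the monad: \<open>f\<^sub>! -| f\<^sup>!\<close> (\<open>direct_inverse_image_hom\<close>) and \<open>s -| y\<close>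
  (\<open>mult_yoneda_hom\<close>).  They are convenient because the right adjoints have no suprema in them:
  \<open>f\<^sup>! \<tau>\<close> is \<open>\<tau>\<close> precomposed with \<open>f\<close>, and \<open>y\<close> is a hom.  They give that
  \<open>sup\<^bsub>P X\<^esub> = s\<close>, that \<open>s\<close> is natural and associative and that \<open>s\<close> retracts both \<open>y\<close> and \<open>y\<^sub>!\<close>.

  For \<open>\<lambda> = y \<cdot> s\<close> the laws of the monad turn flatness and all conditions of a distributive law
  into equations, except for \<open>y\<^sub>! \<le> \<lambda> \<cdot> y = y\<close>, which is the transpose under \<open>s -| y\<close> of
  \<open>s \<cdot> y\<^sub>! = 1\<close>.

  The structure maps of lax algebras and of closure spaces on \<open>X\<close> are both endofunctors of
  \<open>P X\<close>, and the two kinds of structure are the same (\<open>lax_algebra_eq_closure_space\<close>).  Since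
  \<open>s \<cdot> p\<^sub>! \<cdot> y = s \<cdot> y \<cdot> p = p\<close>, the associativity condition of a lax algebra says
  \<open>p \<cdot> s \<cdot> p\<^sub>! \<le> p \<cdot> s\<close>.  Precomposed with \<open>y\<close> this is \<open>p \<cdot> p \<le> p\<close>.  The unit condition
  \<open>y \<le> p \<cdot> y\<close> amounts to \<open>1 \<le> p\<close>, because the value of a presheaf at \<open>x\<close> is its hom from
  \<open>y x\<close>.  Conversely every endofunctor satisfies \<open>s \<cdot> p\<^sub>! \<le> p \<cdot> s\<close>, so \<open>p \<cdot> p = p\<close> gives
  \<open>p \<cdot> s \<cdot> p\<^sub>! \<le> p \<cdot> p \<cdot> s = p \<cdot> s\<close>.  Morphisms and their order are defined by the same
  formulas on both sides, so the two 2-categories are equal and the isomorphism is the identity.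
\<close>

section \<open>Arrows of a quantaloid\<close>

locale quantaloid_calculus =
  fixes Q :: "('o, 'a) quantaloid" (structure)
  assumes quantaloid_axioms: "quantaloid Q"
begin

lemmas quantaloid_laws = quantaloid_axioms[unfolded quantaloid_def]

lemma arrs_obj:
  assumes "u \<in> arrs Q r s"
  shows "r \<in> obj Q" "s \<in> obj Q"
proof -
  have "u \<in> arr Q" "src Q u = r" "tgt Q u = s" using assms by (auto simp: hom_def)
  then show "r \<in> obj Q" "s \<in> obj Q" using quantaloid_laws[THEN conjunct1] by blast+
qed

lemma ide_arr: "r \<in> obj Q \<Longrightarrow> ide Q r \<in> arrs Q r r"
  using quantaloid_laws[THEN conjunct2, THEN conjunct1] by blast

lemma cmp_arr:
  assumes v: "v \<in> arrs Q s t" and u: "u \<in> arrs Q r s"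
  shows "v \<cdot> u \<in> arrs Q r t"
  using quantaloid_laws[THEN conjunct2, THEN conjunct2, THEN conjunct1, rule_format,
      OF arrs_obj(1)[OF u] arrs_obj[OF v] u v] .

lemma cmp_ide:
  assumes u: "u \<in> arrs Q r s"
  shows "u \<cdot> ide Q r = u" "ide Q s \<cdot> u = u"
  using quantaloid_laws[THEN conjunct2, THEN conjunct2, THEN conjunct2, THEN conjunct1, rule_format,
      OF arrs_obj[OF u] u] by auto

lemma cmp_assoc:
  assumes w: "w \<in> arrs Q s t" and v: "v \<in> arrs Q r s" and u: "u \<in> arrs Q q r"
  shows "w \<cdot> v \<cdot> u = w \<cdot> (v \<cdot> u)"
  using quantaloid_laws[THEN conjunct2, THEN conjunct2, THEN conjunct2, THEN conjunct2, THEN conjunct1,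
      rule_format, OF arrs_obj[OF u] arrs_obj[OF w] u v w] .

lemma hom_complete_lattice: "\<lbrakk>r \<in> obj Q; s \<in> obj Q\<rbrakk> \<Longrightarrow> complete_lattice (hom Q r s)"
  using quantaloid_laws[THEN conjunct2, THEN conjunct2, THEN conjunct2, THEN conjunct2, THEN conjunct2,
      THEN conjunct1] by blast

lemma cmp_sup_left:
  assumes A: "A \<subseteq> arrs Q s t" and u: "u \<in> arrs Q r s" and t: "t \<in> obj Q"
  shows "(\<Squnion>\<^bsub>hom Q s t\<^esub> A) \<cdot> u = \<Squnion>\<^bsub>hom Q r t\<^esub> ((\<lambda>v. v \<cdot> u) ` A)"
  using quantaloid_laws[THEN conjunct2, THEN conjunct2, THEN conjunct2, THEN conjunct2, THEN conjunct2,
      THEN conjunct2, THEN conjunct1, rule_format, OF arrs_obj[OF u] t u A] .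

lemma cmp_sup_right:
  assumes A: "A \<subseteq> arrs Q r s" and v: "v \<in> arrs Q s t" and r: "r \<in> obj Q"
  shows "v \<cdot> (\<Squnion>\<^bsub>hom Q r s\<^esub> A) = \<Squnion>\<^bsub>hom Q r t\<^esub> ((\<lambda>u. v \<cdot> u) ` A)"
  using quantaloid_laws[THEN conjunct2, THEN conjunct2, THEN conjunct2, THEN conjunct2, THEN conjunct2,
      THEN conjunct2, THEN conjunct2, rule_format, OF r arrs_obj[OF v] v A] .

lemma le_hom: "le (hom Q r s) = leq Q"
  by (simp add: hom_def)

lemma leq_refl:
  assumes "u \<in> arrs Q r s"
  shows "u \<preceq> u"
proof -
  interpret complete_lattice "hom Q r s"
    using hom_complete_lattice arrs_obj assms by blast
  show ?thesis using assms le_refl by (simp add: le_hom)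
qed

lemma leq_trans:
  assumes "u \<preceq> v" "v \<preceq> w" "u \<in> arrs Q r s" "v \<in> arrs Q r s" "w \<in> arrs Q r s"
  shows "u \<preceq> w"
proof -
  interpret complete_lattice "hom Q r s"
    using hom_complete_lattice arrs_obj assms by blast
  show ?thesis using assms le_trans[of u v w] by (simp add: le_hom)
qed

lemma leq_antisym:
  assumes "u \<preceq> v" "v \<preceq> u" "u \<in> arrs Q r s" "v \<in> arrs Q r s"
  shows "u = v"
proof -
  interpret complete_lattice "hom Q r s"
    using hom_complete_lattice arrs_obj assms by blast
  show ?thesis using assms le_antisym[of u v] by (simp add: le_hom)
qed

lemma sup_arr:
  assumes "A \<subseteq> arrs Q r s" "r \<in> obj Q" "s \<in> obj Q"
  shows "\<Squnion>\<^bsub>hom Q r s\<^esub> A \<in> arrs Q r s"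
proof -
  interpret complete_lattice "hom Q r s"
    using hom_complete_lattice assms by blast
  show ?thesis using assms by simp
qed

lemma sup_upper:
  assumes "A \<subseteq> arrs Q r s" "a \<in> A"
  shows "a \<preceq> \<Squnion>\<^bsub>hom Q r s\<^esub> A"
proof -
  interpret complete_lattice "hom Q r s"
    using hom_complete_lattice arrs_obj assms by blast
  show ?thesis using sup_upper[OF assms] by (simp add: le_hom)
qed

lemma sup_least:
  assumes "A \<subseteq> arrs Q r s" "w \<in> arrs Q r s" "\<And>a. a \<in> A \<Longrightarrow> a \<preceq> w"
  shows "\<Squnion>\<^bsub>hom Q r s\<^esub> A \<preceq> w"
proof -
  interpret complete_lattice "hom Q r s"
    using hom_complete_lattice arrs_obj assms by blast
  show ?thesis using sup_least[of A w] assms by (auto simp: le_hom Upper_def)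
qed

lemma sup_leq_iff:
  assumes "A \<subseteq> arrs Q r s" "w \<in> arrs Q r s"
  shows "\<Squnion>\<^bsub>hom Q r s\<^esub> A \<preceq> w \<longleftrightarrow> (\<forall>a \<in> A. a \<preceq> w)"
proof
  assume *: "\<Squnion>\<^bsub>hom Q r s\<^esub> A \<preceq> w"
  have "\<Squnion>\<^bsub>hom Q r s\<^esub> A \<in> arrs Q r s"
    using assms arrs_obj sup_arr by blast
  then show "\<forall>a \<in> A. a \<preceq> w"
    using leq_trans[OF sup_upper[OF assms(1)] *] assms by blast
next
  assume "\<forall>a \<in> A. a \<preceq> w"
  then show "\<Squnion>\<^bsub>hom Q r s\<^esub> A \<preceq> w"
    using assms sup_least by blast
qed

lemma inf_arr:
  assumes "A \<subseteq> arrs Q r s" "r \<in> obj Q" "s \<in> obj Q"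
  shows "\<Sqinter>\<^bsub>hom Q r s\<^esub> A \<in> arrs Q r s"
proof -
  interpret complete_lattice "hom Q r s"
    using hom_complete_lattice assms by blast
  show ?thesis using assms by simp
qed

lemma leq_inf_iff:
  assumes A: "A \<subseteq> arrs Q r s" and w: "w \<in> arrs Q r s"
  shows "w \<preceq> \<Sqinter>\<^bsub>hom Q r s\<^esub> A \<longleftrightarrow> (\<forall>a \<in> A. w \<preceq> a)"
proof -
  interpret complete_lattice "hom Q r s"
    using hom_complete_lattice arrs_obj w by blast
  have cl: "\<Sqinter>\<^bsub>hom Q r s\<^esub> A \<in> arrs Q r s"
    using A by simp
  have "\<Sqinter>\<^bsub>hom Q r s\<^esub> A \<preceq> a" if "a \<in> A" for a
    using inf_lower[OF A that] by (simp add: le_hom)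
  then have "\<forall>a \<in> A. w \<preceq> a" if "w \<preceq> \<Sqinter>\<^bsub>hom Q r s\<^esub> A"
    using leq_trans[OF that _ w cl] that A by blast
  moreover have "w \<preceq> \<Sqinter>\<^bsub>hom Q r s\<^esub> A" if "\<forall>a \<in> A. w \<preceq> a"
    using inf_greatest[of A w] that A w by (auto simp: le_hom Lower_def)
  ultimately show ?thesis by blast
qed

text \<open>
  The axioms only say that composition preserves suprema.  Its monotonicity comes from suprema of
  comparable pairs.
\<close>

lemma sup_pair:
  assumes "u \<preceq> v" "u \<in> arrs Q r s" "v \<in> arrs Q r s"
  shows "\<Squnion>\<^bsub>hom Q r s\<^esub> {u, v} = v"
proof -
  have sub: "{u, v} \<subseteq> arrs Q r s" using assms by blast
  have arr: "\<Squnion>\<^bsub>hom Q r s\<^esub> {u, v} \<in> arrs Q r s"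
    using sup_arr[OF sub] arrs_obj assms by blast
  have "\<Squnion>\<^bsub>hom Q r s\<^esub> {u, v} \<preceq> v"
    using sup_least[OF sub assms(3)] assms leq_refl by blast
  moreover have "v \<preceq> \<Squnion>\<^bsub>hom Q r s\<^esub> {u, v}"
    using sup_upper[OF sub] by blast
  ultimately show ?thesis using arr assms leq_antisym by blast
qed

lemma cmp_mono:
  assumes "v \<preceq> v'" "u \<preceq> u'"
    and "v \<in> arrs Q s t" "v' \<in> arrs Q s t" "u \<in> arrs Q r s" "u' \<in> arrs Q r s"
  shows "v \<cdot> u \<preceq> v' \<cdot> u'"
proof -
  have obj: "r \<in> obj Q" "s \<in> obj Q" "t \<in> obj Q" using assms arrs_obj by blast+
  have "v' \<cdot> u = \<Squnion>\<^bsub>hom Q r t\<^esub> {v \<cdot> u, v' \<cdot> u}"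
    using cmp_sup_left[of "{v, v'}" s t u r] sup_pair[OF assms(1,3,4)] assms obj by simp
  then have 1: "v \<cdot> u \<preceq> v' \<cdot> u"
    using sup_upper[of "{v \<cdot> u, v' \<cdot> u}" r t "v \<cdot> u"] cmp_arr assms by auto
  have "v' \<cdot> u' = \<Squnion>\<^bsub>hom Q r t\<^esub> {v' \<cdot> u, v' \<cdot> u'}"
    using cmp_sup_right[of "{u, u'}" r s v' t] sup_pair[OF assms(2,5,6)] assms obj by simp
  then have 2: "v' \<cdot> u \<preceq> v' \<cdot> u'"
    using sup_upper[of "{v' \<cdot> u, v' \<cdot> u'}" r t "v' \<cdot> u"] cmp_arr assms by auto
  show ?thesis
    by (rule leq_trans[OF 1 2]) (rule cmp_arr; fact)+
qed

text \<open>
  The supremum of all solutions \<open>v\<close> is itself a solution, as composition with \<open>u\<close> preserves it.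
\<close>

lemma residual_exists:
  assumes u: "u \<in> arrs Q r s" and w: "w \<in> arrs Q r t"
  shows "\<exists>x \<in> arrs Q s t. \<forall>v \<in> arrs Q s t. v \<cdot> u \<preceq> w \<longleftrightarrow> v \<preceq> x"
proof
  have obj: "r \<in> obj Q" "s \<in> obj Q" "t \<in> obj Q" using assms arrs_obj by blast+
  let ?A = "{v \<in> arrs Q s t. v \<cdot> u \<preceq> w}"
  let ?x = "\<Squnion>\<^bsub>hom Q s t\<^esub> ?A"
  have sub: "?A \<subseteq> arrs Q s t" by blast
  show x: "?x \<in> arrs Q s t" using sup_arr[OF sub] obj by blast
  have sub': "(\<lambda>v. v \<cdot> u) ` ?A \<subseteq> arrs Q r t" using cmp_arr[OF _ u] by blast
  have xu: "?x \<cdot> u \<preceq> w"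
    unfolding cmp_sup_left[OF sub u obj(3)] by (rule sup_least[OF sub' w]) blast
  show "\<forall>v \<in> arrs Q s t. v \<cdot> u \<preceq> w \<longleftrightarrow> v \<preceq> ?x"
  proof (intro ballI iffI)
    fix v assume "v \<in> arrs Q s t" "v \<cdot> u \<preceq> w"
    then show "v \<preceq> ?x" using sup_upper[OF sub] by blast
  next
    fix v assume v: "v \<in> arrs Q s t" "v \<preceq> ?x"
    then have "v \<cdot> u \<preceq> ?x \<cdot> u" using cmp_mono[OF _ leq_refl[OF u] _ x u u] by blast
    then show "v \<cdot> u \<preceq> w"
      using leq_trans[OF _ xu cmp_arr[OF v(1) u] cmp_arr[OF x u] w] by blast
  qed
qed

lemma residual_props:
  assumes u: "u \<in> arrs Q r s" and w: "w \<in> arrs Q r t"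
  shows "residual Q w u \<in> arrs Q s t \<and> (\<forall>v \<in> arrs Q s t. v \<cdot> u \<preceq> w \<longleftrightarrow> v \<preceq> residual Q w u)"
proof -
  have tgts: "tgt Q u = s" "tgt Q w = t" using u w by (auto simp: hom_def)
  have "\<exists>!x. x \<in> arrs Q s t \<and> (\<forall>v \<in> arrs Q s t. v \<cdot> u \<preceq> w \<longleftrightarrow> v \<preceq> x)"
  proof (rule ex_ex1I)
    show "\<exists>x. x \<in> arrs Q s t \<and> (\<forall>v \<in> arrs Q s t. v \<cdot> u \<preceq> w \<longleftrightarrow> v \<preceq> x)"
      using residual_exists[OF assms] by blast
  next
    fix x y
    assume "x \<in> arrs Q s t \<and> (\<forall>v \<in> arrs Q s t. v \<cdot> u \<preceq> w \<longleftrightarrow> v \<preceq> x)"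
      and "y \<in> arrs Q s t \<and> (\<forall>v \<in> arrs Q s t. v \<cdot> u \<preceq> w \<longleftrightarrow> v \<preceq> y)"
    then show "x = y" using leq_refl leq_antisym by metis
  qed
  from theI'[OF this] show ?thesis unfolding residual_def tgts .
qed

lemmas residual_arr = residual_props[THEN conjunct1]

lemma leq_residual_iff:
  "\<lbrakk>u \<in> arrs Q r s; w \<in> arrs Q r t; v \<in> arrs Q s t\<rbrakk> \<Longrightarrow> v \<preceq> residual Q w u \<longleftrightarrow> v \<cdot> u \<preceq> w"
  using residual_props by blast

section \<open>Categories\<close>

lemma etype_obj: "\<lbrakk>qcategory Q X; x \<in> carrier X\<rbrakk> \<Longrightarrow> etype X x \<in> obj Q"
  unfolding qcategory_def by blast

lemma chom_arr:
  "\<lbrakk>qcategory Q X; x \<in> carrier X; y \<in> carrier X\<rbrakk> \<Longrightarrow> chom X x y \<in> arrs Q (etype X x) (etype X y)"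
  unfolding qcategory_def qrel_def by blast

lemma ide_leq_chom: "\<lbrakk>qcategory Q X; x \<in> carrier X\<rbrakk> \<Longrightarrow> ide Q (etype X x) \<preceq> chom X x x"
  unfolding qcategory_def by blast

lemma chom_undefined:
  "\<lbrakk>qcategory Q X; \<not> (x \<in> carrier X \<and> y \<in> carrier X)\<rbrakk> \<Longrightarrow> chom X x y = undefined"
  unfolding qcategory_def qrel_def by blast

lemma chom_cmp:
  assumes X: "qcategory Q X" and x: "x \<in> carrier X" and y: "y \<in> carrier X" and z: "z \<in> carrier X"
  shows "chom X y z \<cdot> chom X x y \<preceq> chom X x z"
proof -
  have "\<Squnion>\<^bsub>hom Q (etype X x) (etype X z)\<^esub> ((\<lambda>y. chom X y z \<cdot> chom X x y) ` carrier X) \<preceq> chom X x z"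
    using assms unfolding qcategory_def rel_le_def rel_comp_def by auto
  moreover have "(\<lambda>y. chom X y z \<cdot> chom X x y) ` carrier X \<subseteq> arrs Q (etype X x) (etype X z)"
    using cmp_arr[OF chom_arr[OF X _ z] chom_arr[OF X x]] by blast
  ultimately show ?thesis
    using sup_leq_iff[OF _ chom_arr[OF X x z]] y by blast
qed

lemma qcategoryI:
  assumes "etype X \<in> carrier X \<rightarrow>\<^sub>E obj Q"
    and chom: "\<And>x y. \<lbrakk>x \<in> carrier X; y \<in> carrier X\<rbrakk> \<Longrightarrow> chom X x y \<in> arrs Q (etype X x) (etype X y)"
    and "\<And>x y. \<not> (x \<in> carrier X \<and> y \<in> carrier X) \<Longrightarrow> chom X x y = undefined"
    and "\<And>x. x \<in> carrier X \<Longrightarrow> ide Q (etype X x) \<preceq> chom X x x"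
    and trans: "\<And>x y z. \<lbrakk>x \<in> carrier X; y \<in> carrier X; z \<in> carrier X\<rbrakk> \<Longrightarrow>
      chom X y z \<cdot> chom X x y \<preceq> chom X x z"
  shows "qcategory Q X"
proof -
  have "\<Squnion>\<^bsub>hom Q (etype X x) (etype X z)\<^esub> ((\<lambda>y. chom X y z \<cdot> chom X x y) ` carrier X) \<preceq> chom X x z"
    if x: "x \<in> carrier X" and z: "z \<in> carrier X" for x z
  proof (rule sup_least)
    show "(\<lambda>y. chom X y z \<cdot> chom X x y) ` carrier X \<subseteq> arrs Q (etype X x) (etype X z)"
      using cmp_arr[OF chom[OF _ z] chom[OF x]] by blast
  qed (use chom trans x z in auto)
  then show ?thesis
    using assms unfolding qcategory_def qrel_def rel_le_def rel_comp_def by auto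
qed

lemma cat_le_refl: "\<lbrakk>qcategory Q X; x \<in> carrier X\<rbrakk> \<Longrightarrow> cat_le Q X x x"
  by (simp add: cat_le_def ide_leq_chom)

lemma cat_le_trans:
  assumes X: "qcategory Q X" and x: "x \<in> carrier X" and y: "y \<in> carrier X" and z: "z \<in> carrier X"
    and xy: "cat_le Q X x y" and yz: "cat_le Q X y z"
  shows "cat_le Q X x z"
proof -
  let ?r = "etype X x"
  have types: "etype X y = ?r" "etype X z = ?r" using xy yz unfolding cat_le_def by auto
  have i: "ide Q ?r \<in> arrs Q ?r ?r" using ide_arr[OF etype_obj[OF X x]] .
  have h: "chom X x y \<in> arrs Q ?r ?r" "chom X y z \<in> arrs Q ?r ?r" "chom X x z \<in> arrs Q ?r ?r"
    using chom_arr[OF X] x y z types by metis+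
  have "ide Q ?r \<cdot> ide Q ?r \<preceq> chom X y z \<cdot> chom X x y"
    using cmp_mono[OF _ _ i h(2) i h(1)] xy yz unfolding cat_le_def types(1) by blast
  then have "ide Q ?r \<preceq> chom X y z \<cdot> chom X x y" using cmp_ide i by metis
  then have "ide Q ?r \<preceq> chom X x z"
    using leq_trans[OF _ chom_cmp[OF X x y z] i cmp_arr[OF h(2,1)] h(3)] by blast
  then show ?thesis unfolding cat_le_def using types by auto
qed

lemma functor_closed: "\<lbrakk>f \<in> qfunctors Q X Y; x \<in> carrier X\<rbrakk> \<Longrightarrow> f x \<in> carrier Y"
  unfolding qfunctors_def by blast

lemma functor_etype: "\<lbrakk>f \<in> qfunctors Q X Y; x \<in> carrier X\<rbrakk> \<Longrightarrow> etype Y (f x) = etype X x"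
  unfolding qfunctors_def by blast

lemma functor_chom:
  "\<lbrakk>f \<in> qfunctors Q X Y; x \<in> carrier X; x' \<in> carrier X\<rbrakk> \<Longrightarrow> chom X x x' \<preceq> chom Y (f x) (f x')"
  unfolding qfunctors_def by blast

lemma functor_extensional: "f \<in> qfunctors Q X Y \<Longrightarrow> f \<in> extensional (carrier X)"
  unfolding qfunctors_def by (auto simp: PiE_def)

lemma functor_mono:
  assumes X: "qcategory Q X" and Y: "qcategory Q Y" and f: "f \<in> qfunctors Q X Y"
    and x: "x \<in> carrier X" and x': "x' \<in> carrier X" and le: "cat_le Q X x x'"
  shows "cat_le Q Y (f x) (f x')"
proof -
  let ?r = "etype X x"
  have t: "etype X x' = ?r" "etype Y (f x) = ?r" "etype Y (f x') = ?r"
    using le functor_etype[OF f] x x' unfolding cat_le_def by auto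
  have "ide Q ?r \<in> arrs Q ?r ?r" using ide_arr[OF etype_obj[OF X x]] .
  moreover have "chom X x x' \<in> arrs Q ?r ?r" using chom_arr[OF X x x'] t by simp
  moreover have "chom Y (f x) (f x') \<in> arrs Q ?r ?r"
    using chom_arr[OF Y functor_closed[OF f x] functor_closed[OF f x']] t by simp
  ultimately have "ide Q ?r \<preceq> chom Y (f x) (f x')"
    using le functor_chom[OF f x x'] leq_trans unfolding cat_le_def by blast
  then show ?thesis unfolding cat_le_def using t by simp
qed

lemma id_functor:
  assumes "qcategory Q X"
  shows "id_functor X \<in> qfunctors Q X X"
  using leq_refl[OF chom_arr[OF assms]] unfolding qfunctors_def id_functor_def by auto

lemma compose_functor:
  assumes X: "qcategory Q X" and Y: "qcategory Q Y" and Z: "qcategory Q Z"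
    and f: "f \<in> qfunctors Q X Y" and g: "g \<in> qfunctors Q Y Z"
  shows "compose (carrier X) g f \<in> qfunctors Q X Z"
proof -
  have "chom X x x' \<preceq> chom Z (g (f x)) (g (f x'))" if x: "x \<in> carrier X" and x': "x' \<in> carrier X" for x x'
  proof -
    have fx: "f x \<in> carrier Y" "f x' \<in> carrier Y" using functor_closed[OF f] x x' by auto
    have gx: "g (f x) \<in> carrier Z" "g (f x') \<in> carrier Z" using functor_closed[OF g] fx by auto
    show ?thesis
      using leq_trans[OF functor_chom[OF f x x'] functor_chom[OF g fx]]
        chom_arr[OF X x x'] chom_arr[OF Y fx] chom_arr[OF Z gx]
        functor_etype[OF f] functor_etype[OF g] fx x x' by metis
  qed
  then show ?thesis
    using functor_closed[OF f] functor_closed[OF g] functor_etype[OF f] functor_etype[OF g]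
    unfolding qfunctors_def by (auto simp: compose_eq compose_extensional PiE_def)
qed

section \<open>Presheaf categories\<close>

abbreviation PSh :: "('o, 'a, 'x) qcat \<Rightarrow> ('o, 'a, 'x) presheaf set" where
  "PSh X \<equiv> carrier (psh Q X)"

abbreviation val :: "('o, 'a, 'x) presheaf \<Rightarrow> 'x \<Rightarrow> 'a" where
  "val \<sigma> x \<equiv> snd \<sigma> x ()"

lemma one_object_simps:
  "carrier (one_object Q s) = UNIV" "etype (one_object Q s) y = s" "chom (one_object Q s) y z = ide Q s"
  by (simp_all add: one_object_def)

text \<open>
  Composing with the identity hom of a single object changes nothing, so the distributor
  condition becomes a right action of \<open>X\<close>.
\<close>

lemma presheaf_iff:
  assumes X: "qcategory Q X"
  shows "\<sigma> \<in> PSh X \<longleftrightarrow> fst \<sigma> \<in> obj Q \<and>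
    (\<forall>x \<in> carrier X. val \<sigma> x \<in> arrs Q (etype X x) (fst \<sigma>)) \<and>
    (\<forall>x. x \<notin> carrier X \<longrightarrow> val \<sigma> x = undefined) \<and>
    (\<forall>x \<in> carrier X. \<forall>x' \<in> carrier X. val \<sigma> x' \<cdot> chom X x x' \<preceq> val \<sigma> x)"
proof -
  define s where "s = fst \<sigma>"
  define rel where "rel \<longleftrightarrow> (\<forall>x \<in> carrier X. val \<sigma> x \<in> arrs Q (etype X x) s) \<and>
    (\<forall>x. x \<notin> carrier X \<longrightarrow> val \<sigma> x = undefined)"
  have car: "\<sigma> \<in> PSh X \<longleftrightarrow> s \<in> obj Q \<and> snd \<sigma> \<in> distributors Q X (one_object Q s)"
    unfolding psh_def s_def by (cases \<sigma>) (auto simp: Let_def)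
  have qrel: "snd \<sigma> \<in> qrel Q X (one_object Q s) \<longleftrightarrow> rel"
    unfolding qrel_def rel_def by (auto simp: one_object_simps)
  have act: "rel_le Q X (one_object Q s)
      (rel_comp Q X (one_object Q s) (one_object Q s) (chom (one_object Q s))
        (rel_comp Q X X (one_object Q s) (snd \<sigma>) (chom X))) (snd \<sigma>) \<longleftrightarrow>
    (\<forall>x \<in> carrier X. \<forall>x' \<in> carrier X. val \<sigma> x' \<cdot> chom X x x' \<preceq> val \<sigma> x)"
    if s: "s \<in> obj Q" and rel: rel
  proof -
    have "\<Squnion>\<^bsub>hom Q (etype X x) s\<^esub> {ide Q s \<cdot> \<Squnion>\<^bsub>hom Q (etype X x) s\<^esub> ((\<lambda>x'. val \<sigma> x' \<cdot> chom X x x') ` carrier X)}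
        \<preceq> val \<sigma> x \<longleftrightarrow> (\<forall>x' \<in> carrier X. val \<sigma> x' \<cdot> chom X x x' \<preceq> val \<sigma> x)"
      if x: "x \<in> carrier X" for x
    proof -
      have v: "val \<sigma> y \<in> arrs Q (etype X y) s" if "y \<in> carrier X" for y
        using rel that unfolding rel_def by blast
      let ?A = "(\<lambda>x'. val \<sigma> x' \<cdot> chom X x x') ` carrier X"
      let ?S = "\<Squnion>\<^bsub>hom Q (etype X x) s\<^esub> ?A"
      have A: "?A \<subseteq> arrs Q (etype X x) s" using cmp_arr[OF v chom_arr[OF X x]] by blast
      have S: "?S \<in> arrs Q (etype X x) s" using sup_arr[OF A etype_obj[OF X x] s] .
      have "\<Squnion>\<^bsub>hom Q (etype X x) s\<^esub> {ide Q s \<cdot> ?S} \<preceq> val \<sigma> x \<longleftrightarrow> ?S \<preceq> val \<sigma> x"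
        using sup_leq_iff[of "{?S}", OF _ v[OF x]] S by (simp add: cmp_ide(2)[OF S])
      also have "\<dots> \<longleftrightarrow> (\<forall>x' \<in> carrier X. val \<sigma> x' \<cdot> chom X x x' \<preceq> val \<sigma> x)"
        using sup_leq_iff[OF A v[OF x]] by simp
      finally show ?thesis .
    qed
    then show ?thesis
      unfolding rel_le_def rel_comp_def by (simp add: one_object_simps UNIV_unit)
  qed
  have "\<sigma> \<in> PSh X \<longleftrightarrow> s \<in> obj Q \<and> rel \<and>
    (\<forall>x \<in> carrier X. \<forall>x' \<in> carrier X. val \<sigma> x' \<cdot> chom X x x' \<preceq> val \<sigma> x)"
    unfolding car distributors_def using qrel act by auto
  then show ?thesis unfolding rel_def s_def by blast
qed

lemma presheaf_obj: "\<lbrakk>qcategory Q X; \<sigma> \<in> PSh X\<rbrakk> \<Longrightarrow> fst \<sigma> \<in> obj Q"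
  using presheaf_iff by blast

lemma presheaf_val: "\<lbrakk>qcategory Q X; \<sigma> \<in> PSh X; x \<in> carrier X\<rbrakk> \<Longrightarrow> val \<sigma> x \<in> arrs Q (etype X x) (fst \<sigma>)"
  using presheaf_iff by blast

lemma presheaf_act:
  "\<lbrakk>qcategory Q X; \<sigma> \<in> PSh X; x \<in> carrier X; x' \<in> carrier X\<rbrakk> \<Longrightarrow> val \<sigma> x' \<cdot> chom X x x' \<preceq> val \<sigma> x"
  using presheaf_iff by blast

lemma presheaf_eqI:
  assumes X: "qcategory Q X" and \<sigma>: "\<sigma> \<in> PSh X" and \<tau>: "\<tau> \<in> PSh X"
    and "fst \<sigma> = fst \<tau>" and val: "\<And>x. x \<in> carrier X \<Longrightarrow> val \<sigma> x = val \<tau> x"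
  shows "\<sigma> = \<tau>"
proof -
  have "val \<sigma> x = val \<tau> x" for x
    using val \<sigma> \<tau> unfolding presheaf_iff[OF X] by metis
  then have "snd \<sigma> = snd \<tau>" by (intro ext) simp
  then show ?thesis using assms by (simp add: prod_eq_iff)
qed

lemma etype_psh: "\<sigma> \<in> PSh X \<Longrightarrow> etype (psh Q X) \<sigma> = fst \<sigma>"
  unfolding psh_def Let_def by auto

lemma chom_psh:
  "\<lbrakk>\<sigma> \<in> PSh X; \<tau> \<in> PSh X\<rbrakk> \<Longrightarrow> chom (psh Q X) \<sigma> \<tau> =
    \<Sqinter>\<^bsub>hom Q (fst \<sigma>) (fst \<tau>)\<^esub> ((\<lambda>x. residual Q (val \<tau> x) (val \<sigma> x)) ` carrier X)"
  unfolding psh_def Let_def by simp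

lemma residuals_arr:
  assumes X: "qcategory Q X" and \<sigma>: "\<sigma> \<in> PSh X" and \<tau>: "\<tau> \<in> PSh X"
  shows "(\<lambda>x. residual Q (val \<tau> x) (val \<sigma> x)) ` carrier X \<subseteq> arrs Q (fst \<sigma>) (fst \<tau>)"
  using residual_arr[OF presheaf_val[OF X \<sigma>] presheaf_val[OF X \<tau>]] by blast

lemma chom_psh_arr:
  assumes X: "qcategory Q X" and \<sigma>: "\<sigma> \<in> PSh X" and \<tau>: "\<tau> \<in> PSh X"
  shows "chom (psh Q X) \<sigma> \<tau> \<in> arrs Q (fst \<sigma>) (fst \<tau>)"
  unfolding chom_psh[OF \<sigma> \<tau>]
  using inf_arr[OF residuals_arr[OF assms] presheaf_obj[OF X \<sigma>] presheaf_obj[OF X \<tau>]] .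

text \<open>
  Replaces the meet of residuals by a universal property, which turns equalities between homs of
  presheaves into equivalences of pointwise inequalities.
\<close>

lemma leq_chom_psh_iff:
  assumes X: "qcategory Q X" and \<sigma>: "\<sigma> \<in> PSh X" and \<tau>: "\<tau> \<in> PSh X"
    and u: "u \<in> arrs Q (fst \<sigma>) (fst \<tau>)"
  shows "u \<preceq> chom (psh Q X) \<sigma> \<tau> \<longleftrightarrow> (\<forall>x \<in> carrier X. u \<cdot> val \<sigma> x \<preceq> val \<tau> x)"
  unfolding chom_psh[OF \<sigma> \<tau>] leq_inf_iff[OF residuals_arr[OF X \<sigma> \<tau>] u]
  using leq_residual_iff[OF presheaf_val[OF X \<sigma>] presheaf_val[OF X \<tau>] u] by simp

lemma chom_psh_act:
  assumes X: "qcategory Q X" and \<sigma>: "\<sigma> \<in> PSh X" and \<tau>: "\<tau> \<in> PSh X" and x: "x \<in> carrier X"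
  shows "chom (psh Q X) \<sigma> \<tau> \<cdot> val \<sigma> x \<preceq> val \<tau> x"
  using leq_chom_psh_iff[OF X \<sigma> \<tau> chom_psh_arr[OF X \<sigma> \<tau>]] leq_refl[OF chom_psh_arr[OF X \<sigma> \<tau>]] x
  by blast

lemma qcategory_psh:
  assumes X: "qcategory Q X"
  shows "qcategory Q (psh Q X)"
proof (rule qcategoryI)
  show "etype (psh Q X) \<in> PSh X \<rightarrow>\<^sub>E obj Q"
    unfolding psh_def Let_def by auto
  show "chom (psh Q X) \<sigma> \<tau> \<in> arrs Q (etype (psh Q X) \<sigma>) (etype (psh Q X) \<tau>)"
    if "\<sigma> \<in> PSh X" "\<tau> \<in> PSh X" for \<sigma> \<tau>
    using chom_psh_arr[OF X that] that by (simp add: etype_psh)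
  show "chom (psh Q X) \<sigma> \<tau> = undefined" if "\<not> (\<sigma> \<in> PSh X \<and> \<tau> \<in> PSh X)" for \<sigma> \<tau>
    using that unfolding psh_def Let_def by auto
  show "ide Q (etype (psh Q X) \<sigma>) \<preceq> chom (psh Q X) \<sigma> \<sigma>" if \<sigma>: "\<sigma> \<in> PSh X" for \<sigma>
    unfolding etype_psh[OF \<sigma>] leq_chom_psh_iff[OF X \<sigma> \<sigma> ide_arr[OF presheaf_obj[OF X \<sigma>]]]
    by (simp add: cmp_ide[OF presheaf_val[OF X \<sigma>]] leq_refl[OF presheaf_val[OF X \<sigma>]])
next
  fix \<rho> \<sigma> \<tau> assume \<rho>: "\<rho> \<in> PSh X" and \<sigma>: "\<sigma> \<in> PSh X" and \<tau>: "\<tau> \<in> PSh X"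
  let ?u = "chom (psh Q X) \<rho> \<sigma>" and ?v = "chom (psh Q X) \<sigma> \<tau>"
  have u: "?u \<in> arrs Q (fst \<rho>) (fst \<sigma>)" and v: "?v \<in> arrs Q (fst \<sigma>) (fst \<tau>)"
    using chom_psh_arr[OF X] \<rho> \<sigma> \<tau> by blast+
  have "?v \<cdot> ?u \<cdot> val \<rho> x \<preceq> val \<tau> x" if x: "x \<in> carrier X" for x
  proof -
    note vals = presheaf_val[OF X _ x]
    have "?v \<cdot> (?u \<cdot> val \<rho> x) \<preceq> ?v \<cdot> val \<sigma> x"
      using cmp_mono[OF leq_refl[OF v] chom_psh_act[OF X \<rho> \<sigma> x] v v cmp_arr[OF u vals[OF \<rho>]] vals[OF \<sigma>]] .
    then have "?v \<cdot> (?u \<cdot> val \<rho> x) \<preceq> val \<tau> x"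
      using leq_trans[OF _ chom_psh_act[OF X \<sigma> \<tau> x] cmp_arr[OF v cmp_arr[OF u vals[OF \<rho>]]]
          cmp_arr[OF v vals[OF \<sigma>]] vals[OF \<tau>]] by blast
    then show ?thesis by (simp add: cmp_assoc[OF v u vals[OF \<rho>]])
  qed
  then show "?v \<cdot> ?u \<preceq> chom (psh Q X) \<rho> \<tau>"
    using leq_chom_psh_iff[OF X \<rho> \<tau> cmp_arr[OF v u]] by blast
qed

lemma cat_le_psh_iff:
  assumes X: "qcategory Q X" and \<sigma>: "\<sigma> \<in> PSh X" and \<tau>: "\<tau> \<in> PSh X"
  shows "cat_le Q (psh Q X) \<sigma> \<tau> \<longleftrightarrow> fst \<sigma> = fst \<tau> \<and> (\<forall>x \<in> carrier X. val \<sigma> x \<preceq> val \<tau> x)"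
proof -
  have "ide Q (fst \<sigma>) \<in> arrs Q (fst \<sigma>) (fst \<sigma>)" using ide_arr[OF presheaf_obj[OF X \<sigma>]] .
  then show ?thesis
    using leq_chom_psh_iff[OF X \<sigma> \<tau>, of "ide Q (fst \<sigma>)"] cmp_ide(2)[OF presheaf_val[OF X \<sigma>]]
    unfolding cat_le_def by (auto simp: etype_psh[OF \<sigma>] etype_psh[OF \<tau>])
qed

lemma psh_separated:
  assumes X: "qcategory Q X" and \<sigma>: "\<sigma> \<in> PSh X" and \<tau>: "\<tau> \<in> PSh X"
    and "cat_le Q (psh Q X) \<sigma> \<tau>" "cat_le Q (psh Q X) \<tau> \<sigma>"
  shows "\<sigma> = \<tau>"
proof (rule presheaf_eqI[OF X \<sigma> \<tau>])
  show fst: "fst \<sigma> = fst \<tau>" using assms cat_le_psh_iff[OF X] by blast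
  show "val \<sigma> x = val \<tau> x" if x: "x \<in> carrier X" for x
    using leq_antisym[of "val \<sigma> x" "val \<tau> x"] presheaf_val[OF X \<sigma> x] presheaf_val[OF X \<tau> x]
      assms(4,5) x fst unfolding cat_le_psh_iff[OF X \<sigma> \<tau>] cat_le_psh_iff[OF X \<tau> \<sigma>] by metis
qed

text \<open>
  How equations between values of left adjoints are proved: by comparing right adjoints.
\<close>

lemma presheaf_eq_by_upper_bounds:
  assumes X: "qcategory Q X" and \<sigma>: "\<sigma> \<in> PSh X" and \<sigma>': "\<sigma>' \<in> PSh X"
    and ub: "\<And>\<tau>. \<tau> \<in> PSh X \<Longrightarrow> cat_le Q (psh Q X) \<sigma> \<tau> \<longleftrightarrow> cat_le Q (psh Q X) \<sigma>' \<tau>"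
  shows "\<sigma> = \<sigma>'"
proof -
  note refl = cat_le_refl[OF qcategory_psh[OF X]]
  show ?thesis using psh_separated[OF X \<sigma> \<sigma>'] ub[OF \<sigma>] ub[OF \<sigma>'] refl[OF \<sigma>] refl[OF \<sigma>'] by blast
qed

section \<open>The Yoneda embedding\<close>

lemma yoneda_closed:
  assumes X: "qcategory Q X" and x: "x \<in> carrier X"
  shows "yoneda Q X x \<in> PSh X"
  unfolding presheaf_iff[OF X] using x
  by (auto simp: yoneda_def etype_obj[OF X] chom_arr[OF X] chom_undefined[OF X] chom_cmp[OF X])

lemma yoneda_simps:
  assumes "x \<in> carrier X"
  shows "fst (yoneda Q X x) = etype X x" "val (yoneda Q X x) z = chom X z x"
  using assms by (simp_all add: yoneda_def)

text \<open>
  An arrow of presheaves out of \<open>y x\<close> is evaluated at the identity below \<open>chom X x x\<close>; conversely a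
  value at \<open>x\<close> acts on \<open>y x\<close> by the distributor condition.
\<close>

lemma yoneda_lemma:
  assumes X: "qcategory Q X" and x: "x \<in> carrier X" and \<sigma>: "\<sigma> \<in> PSh X"
  shows "chom (psh Q X) (yoneda Q X x) \<sigma> = val \<sigma> x"
proof -
  note y = yoneda_closed[OF X x]
  let ?h = "chom (psh Q X) (yoneda Q X x) \<sigma>"
  have h: "?h \<in> arrs Q (etype X x) (fst \<sigma>)"
    using chom_psh_arr[OF X y \<sigma>] by (simp add: yoneda_simps x)
  note v = presheaf_val[OF X \<sigma> x] and c = chom_arr[OF X x x]
  have "?h \<cdot> ide Q (etype X x) \<preceq> ?h \<cdot> chom X x x"
    using cmp_mono[OF leq_refl[OF h] ide_leq_chom[OF X x] h h ide_arr[OF etype_obj[OF X x]] c] .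
  then have "?h \<preceq> ?h \<cdot> chom X x x" by (simp add: cmp_ide[OF h])
  moreover have "?h \<cdot> chom X x x \<preceq> val \<sigma> x"
    using chom_psh_act[OF X y \<sigma> x] by (simp add: yoneda_simps x)
  ultimately have 1: "?h \<preceq> val \<sigma> x" using leq_trans[OF _ _ h cmp_arr[OF h c] v] by blast
  have "val \<sigma> x \<preceq> ?h"
    using leq_chom_psh_iff[OF X y \<sigma>, of "val \<sigma> x"] v presheaf_act[OF X \<sigma> _ x]
    by (simp add: yoneda_simps x)
  with 1 show ?thesis using leq_antisym[OF _ _ h v] by blast
qed

lemma yoneda_functor:
  assumes X: "qcategory Q X"
  shows "yoneda Q X \<in> qfunctors Q X (psh Q X)"
proof -
  have "chom X x x' \<preceq> chom (psh Q X) (yoneda Q X x) (yoneda Q X x')"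
    if "x \<in> carrier X" "x' \<in> carrier X" for x x'
    using that leq_refl[OF chom_arr[OF X that]]
    by (simp add: yoneda_lemma[OF X _ yoneda_closed[OF X]] yoneda_simps)
  then show ?thesis
    unfolding qfunctors_def using yoneda_closed[OF X]
    by (auto simp: etype_psh yoneda_simps PiE_def) (simp add: yoneda_def)
qed

lemma yoneda_le_iff:
  assumes X: "qcategory Q X" and x: "x \<in> carrier X" and \<sigma>: "\<sigma> \<in> PSh X"
  shows "cat_le Q (psh Q X) (yoneda Q X x) \<sigma> \<longleftrightarrow> etype X x = fst \<sigma> \<and> ide Q (etype X x) \<preceq> val \<sigma> x"
  unfolding cat_le_def yoneda_lemma[OF X x \<sigma>]
  by (simp add: etype_psh yoneda_closed[OF X x] \<sigma> yoneda_simps x)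

section \<open>Direct and inverse images\<close>

lemma inverse_image_fst: "\<tau> \<in> PSh Y \<Longrightarrow> fst (inverse_image Q X Y f \<tau>) = fst \<tau>"
  unfolding inverse_image_def by (cases \<tau>) auto

text \<open>
  The supremum that defines \<open>\<tau> \<circ> f\<^sub>*\<close> is attained at the index \<open>f x\<close>: every term lies below
  \<open>\<tau> (f x)\<close> by the distributor condition, and the term at \<open>f x\<close> lies above it by reflexivity.
\<close>

lemma inverse_image_val:
  assumes X: "qcategory Q X" and Y: "qcategory Q Y" and f: "f \<in> qfunctors Q X Y"
    and \<tau>: "\<tau> \<in> PSh Y" and x: "x \<in> carrier X"
  shows "val (inverse_image Q X Y f \<tau>) x = val \<tau> (f x)"
proof -
  have fx: "f x \<in> carrier Y" and t: "etype Y (f x) = etype X x"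
    using functor_closed[OF f x] functor_etype[OF f x] by auto
  let ?A = "(\<lambda>y. val \<tau> y \<cdot> chom Y (f x) y) ` carrier Y"
  have A: "?A \<subseteq> arrs Q (etype Y (f x)) (fst \<tau>)"
    using cmp_arr[OF presheaf_val[OF Y \<tau>] chom_arr[OF Y fx]] by blast
  note v = presheaf_val[OF Y \<tau> fx]
  let ?S = "\<Squnion>\<^bsub>hom Q (etype Y (f x)) (fst \<tau>)\<^esub> ?A"
  have S: "?S \<in> arrs Q (etype Y (f x)) (fst \<tau>)"
    using sup_arr[OF A etype_obj[OF Y fx] presheaf_obj[OF Y \<tau>]] .
  have eq: "val (inverse_image Q X Y f \<tau>) x = ?S"
    using \<tau> x t unfolding inverse_image_def rel_comp_def graph_def
    by (cases \<tau>) (simp add: one_object_simps)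
  have 1: "?S \<preceq> val \<tau> (f x)"
    using sup_least[OF A v] presheaf_act[OF Y \<tau> fx] by blast
  have "val \<tau> (f x) \<cdot> ide Q (etype Y (f x)) \<preceq> val \<tau> (f x) \<cdot> chom Y (f x) (f x)"
    using cmp_mono[OF leq_refl[OF v] ide_leq_chom[OF Y fx] v v ide_arr[OF etype_obj[OF Y fx]]
        chom_arr[OF Y fx fx]] .
  then have "val \<tau> (f x) \<preceq> val \<tau> (f x) \<cdot> chom Y (f x) (f x)" by (simp add: cmp_ide[OF v])
  moreover have "val \<tau> (f x) \<cdot> chom Y (f x) (f x) \<preceq> ?S"
    using sup_upper[OF A] fx by blast
  ultimately have "val \<tau> (f x) \<preceq> ?S"
    using leq_trans[OF _ _ v cmp_arr[OF v chom_arr[OF Y fx fx]] S] by blast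
  with 1 eq show ?thesis using leq_antisym[OF _ _ S v] by simp
qed

lemma inverse_image_closed:
  assumes X: "qcategory Q X" and Y: "qcategory Q Y" and f: "f \<in> qfunctors Q X Y"
    and \<tau>: "\<tau> \<in> PSh Y"
  shows "inverse_image Q X Y f \<tau> \<in> PSh X"
  unfolding presheaf_iff[OF X] inverse_image_fst[OF \<tau>]
proof (intro conjI ballI allI impI)
  show "fst \<tau> \<in> obj Q" using presheaf_obj[OF Y \<tau>] .
  show "val (inverse_image Q X Y f \<tau>) x \<in> arrs Q (etype X x) (fst \<tau>)" if x: "x \<in> carrier X" for x
    using presheaf_val[OF Y \<tau> functor_closed[OF f x]]
    by (simp add: inverse_image_val[OF assms x] functor_etype[OF f x])
  show "val (inverse_image Q X Y f \<tau>) x = undefined" if "x \<notin> carrier X" for x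
    using \<tau> that unfolding inverse_image_def rel_comp_def by (cases \<tau>) simp
next
  fix x x' assume x: "x \<in> carrier X" and x': "x' \<in> carrier X"
  note fx = functor_closed[OF f x] and fx' = functor_closed[OF f x']
  note t = functor_etype[OF f x] functor_etype[OF f x']
  note c = chom_arr[OF Y fx fx', unfolded t]
  note v = presheaf_val[OF Y \<tau> fx, unfolded t] and v' = presheaf_val[OF Y \<tau> fx', unfolded t]
  have "val \<tau> (f x') \<cdot> chom X x x' \<preceq> val \<tau> (f x') \<cdot> chom Y (f x) (f x')"
    using cmp_mono[OF leq_refl[OF v'] functor_chom[OF f x x'] v' v' chom_arr[OF X x x'] c] .
  then have "val \<tau> (f x') \<cdot> chom X x x' \<preceq> val \<tau> (f x)"
    using leq_trans[OF _ presheaf_act[OF Y \<tau> fx fx'] cmp_arr[OF v' chom_arr[OF X x x']] cmp_arr[OF v' c] v]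
    by blast
  then show "val (inverse_image Q X Y f \<tau>) x' \<cdot> chom X x x' \<preceq> val (inverse_image Q X Y f \<tau>) x"
    by (simp add: inverse_image_val[OF assms] x x')
qed

lemma inverse_image_functor:
  assumes X: "qcategory Q X" and Y: "qcategory Q Y" and f: "f \<in> qfunctors Q X Y"
  shows "inverse_image Q X Y f \<in> qfunctors Q (psh Q Y) (psh Q X)"
proof -
  have "chom (psh Q Y) \<tau> \<tau>' \<preceq> chom (psh Q X) (inverse_image Q X Y f \<tau>) (inverse_image Q X Y f \<tau>')"
    if \<tau>: "\<tau> \<in> PSh Y" and \<tau>': "\<tau>' \<in> PSh Y" for \<tau> \<tau>'
    using leq_chom_psh_iff[OF X inverse_image_closed[OF assms \<tau>] inverse_image_closed[OF assms \<tau>']]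
      chom_psh_act[OF Y \<tau> \<tau>' functor_closed[OF f]] chom_psh_arr[OF Y \<tau> \<tau>']
    by (simp add: inverse_image_fst \<tau> \<tau>' inverse_image_val[OF assms])
  then show ?thesis
    unfolding qfunctors_def using inverse_image_closed[OF assms]
    by (auto simp: etype_psh inverse_image_fst PiE_def) (simp add: inverse_image_def)
qed

lemma direct_image_fst: "\<sigma> \<in> PSh X \<Longrightarrow> fst (direct_image Q X Y f \<sigma>) = fst \<sigma>"
  unfolding direct_image_def by (cases \<sigma>) auto

lemma direct_image_val:
  assumes "\<sigma> \<in> PSh X" "y \<in> carrier Y"
  shows "val (direct_image Q X Y f \<sigma>) y =
    \<Squnion>\<^bsub>hom Q (etype Y y) (fst \<sigma>)\<^esub> ((\<lambda>x. val \<sigma> x \<cdot> chom Y y (f x)) ` carrier X)"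
  using assms unfolding direct_image_def rel_comp_def cograph_def
  by (cases \<sigma>) (simp add: one_object_simps)

lemma direct_image_terms:
  assumes X: "qcategory Q X" and Y: "qcategory Q Y" and f: "f \<in> qfunctors Q X Y"
    and \<sigma>: "\<sigma> \<in> PSh X" and y: "y \<in> carrier Y"
  shows "(\<lambda>x. val \<sigma> x \<cdot> chom Y y (f x)) ` carrier X \<subseteq> arrs Q (etype Y y) (fst \<sigma>)"
proof -
  have "chom Y y (f x) \<in> arrs Q (etype Y y) (etype X x)" if x: "x \<in> carrier X" for x
    using chom_arr[OF Y y functor_closed[OF f x]] by (simp add: functor_etype[OF f x])
  then show ?thesis using cmp_arr[OF presheaf_val[OF X \<sigma>]] by blast
qed

lemma direct_image_val_arr:
  assumes X: "qcategory Q X" and Y: "qcategory Q Y" and f: "f \<in> qfunctors Q X Y"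
    and \<sigma>: "\<sigma> \<in> PSh X" and y: "y \<in> carrier Y"
  shows "val (direct_image Q X Y f \<sigma>) y \<in> arrs Q (etype Y y) (fst \<sigma>)"
  unfolding direct_image_val[OF \<sigma> y]
  using sup_arr[OF direct_image_terms[OF assms] etype_obj[OF Y y] presheaf_obj[OF X \<sigma>]] .

lemma cmp_direct_image_leq_iff:
  assumes X: "qcategory Q X" and Y: "qcategory Q Y" and f: "f \<in> qfunctors Q X Y"
    and \<sigma>: "\<sigma> \<in> PSh X" and y: "y \<in> carrier Y"
    and u: "u \<in> arrs Q (fst \<sigma>) t" and w: "w \<in> arrs Q (etype Y y) t"
  shows "u \<cdot> val (direct_image Q X Y f \<sigma>) y \<preceq> w \<longleftrightarrow> (\<forall>x \<in> carrier X. u \<cdot> val \<sigma> x \<cdot> chom Y y (f x) \<preceq> w)"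
proof -
  let ?A = "(\<lambda>x. val \<sigma> x \<cdot> chom Y y (f x)) ` carrier X"
  note A = direct_image_terms[OF X Y f \<sigma> y]
  have uA: "(\<lambda>v. u \<cdot> v) ` ?A \<subseteq> arrs Q (etype Y y) t" using cmp_arr[OF u] A by blast
  have "u \<cdot> (val \<sigma> x \<cdot> chom Y y (f x)) = u \<cdot> val \<sigma> x \<cdot> chom Y y (f x)" if x: "x \<in> carrier X" for x
    using cmp_assoc[OF u presheaf_val[OF X \<sigma> x], of "chom Y y (f x)"]
      chom_arr[OF Y y functor_closed[OF f x]] by (simp add: functor_etype[OF f x])
  then show ?thesis
    unfolding direct_image_val[OF \<sigma> y] cmp_sup_right[OF A u etype_obj[OF Y y]]
      sup_leq_iff[OF uA w] by simp
qed

lemma direct_image_closed: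
  assumes X: "qcategory Q X" and Y: "qcategory Q Y" and f: "f \<in> qfunctors Q X Y"
    and \<sigma>: "\<sigma> \<in> PSh X"
  shows "direct_image Q X Y f \<sigma> \<in> PSh Y"
  unfolding presheaf_iff[OF Y] direct_image_fst[OF \<sigma>]
proof (intro conjI ballI allI impI)
  show "fst \<sigma> \<in> obj Q" using presheaf_obj[OF X \<sigma>] .
  show "val (direct_image Q X Y f \<sigma>) y \<in> arrs Q (etype Y y) (fst \<sigma>)" if y: "y \<in> carrier Y" for y
    using direct_image_val_arr[OF assms y] .
  show "val (direct_image Q X Y f \<sigma>) y = undefined" if "y \<notin> carrier Y" for y
    using \<sigma> that unfolding direct_image_def rel_comp_def by (cases \<sigma>) simp
next
  fix y y' assume y: "y \<in> carrier Y" and y': "y' \<in> carrier Y"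
  let ?c = "chom Y y y'" and ?w = "val (direct_image Q X Y f \<sigma>) y"
  note c = chom_arr[OF Y y y'] and w = direct_image_val_arr[OF assms y]
  note A = direct_image_terms[OF assms y'] and B = direct_image_terms[OF assms y]
  have Ac: "(\<lambda>v. v \<cdot> ?c) ` (\<lambda>x. val \<sigma> x \<cdot> chom Y y' (f x)) ` carrier X \<subseteq> arrs Q (etype Y y) (fst \<sigma>)"
    using cmp_arr[OF _ c] A by blast
  have "val \<sigma> x \<cdot> chom Y y' (f x) \<cdot> ?c \<preceq> ?w" if x: "x \<in> carrier X" for x
  proof -
    note fx = functor_closed[OF f x] and t = functor_etype[OF f x]
    note v = presheaf_val[OF X \<sigma> x]
    note d = chom_arr[OF Y y fx, unfolded t] and d' = chom_arr[OF Y y' fx, unfolded t]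
    have "val \<sigma> x \<cdot> (chom Y y' (f x) \<cdot> ?c) \<preceq> val \<sigma> x \<cdot> chom Y y (f x)"
      using cmp_mono[OF leq_refl[OF v] chom_cmp[OF Y y y' fx] v v cmp_arr[OF d' c] d] .
    moreover have "val \<sigma> x \<cdot> chom Y y (f x) \<preceq> ?w"
      unfolding direct_image_val[OF \<sigma> y] using sup_upper[OF B] x by blast
    ultimately show ?thesis
      using leq_trans[OF _ _ cmp_arr[OF v cmp_arr[OF d' c]] cmp_arr[OF v d] w]
      by (simp add: cmp_assoc[OF v d' c])
  qed
  then show "val (direct_image Q X Y f \<sigma>) y' \<cdot> ?c \<preceq> ?w"
    unfolding direct_image_val[OF \<sigma> y'] cmp_sup_left[OF A c presheaf_obj[OF X \<sigma>]]
      sup_leq_iff[OF Ac w] by blast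
qed

text \<open>
  An arrow \<open>u\<close> lies below either side iff \<open>u \<cdot> \<sigma> x \<preceq> \<tau> (f x)\<close> for all \<open>x\<close>: in the condition for
  \<open>f\<^sub>! \<sigma>\<close>, which reads \<open>u \<cdot> \<sigma> x \<cdot> Y y (f x) \<preceq> \<tau> y\<close>, the instance \<open>y = f x\<close> implies all others.
\<close>

lemma direct_inverse_image_hom:
  assumes X: "qcategory Q X" and Y: "qcategory Q Y" and f: "f \<in> qfunctors Q X Y"
    and \<sigma>: "\<sigma> \<in> PSh X" and \<tau>: "\<tau> \<in> PSh Y"
  shows "chom (psh Q Y) (direct_image Q X Y f \<sigma>) \<tau> = chom (psh Q X) \<sigma> (inverse_image Q X Y f \<tau>)"
    (is "?l = ?r")
proof -
  note D = direct_image_closed[OF X Y f \<sigma>] and I = inverse_image_closed[OF X Y f \<tau>]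
  have iff: "u \<preceq> ?l \<longleftrightarrow> u \<preceq> ?r" if u: "u \<in> arrs Q (fst \<sigma>) (fst \<tau>)" for u
  proof -
    have "(\<forall>y \<in> carrier Y. u \<cdot> val \<sigma> x \<cdot> chom Y y (f x) \<preceq> val \<tau> y) \<longleftrightarrow> u \<cdot> val \<sigma> x \<preceq> val \<tau> (f x)"
      if x: "x \<in> carrier X" for x
    proof -
      note fx = functor_closed[OF f x] and t = functor_etype[OF f x]
      note uv = cmp_arr[OF u presheaf_val[OF X \<sigma> x]]
      note c = chom_arr[OF Y _ fx, unfolded t]
      note v = presheaf_val[OF Y \<tau> fx, unfolded t]
      have i: "ide Q (etype X x) \<preceq> chom Y (f x) (f x)" using ide_leq_chom[OF Y fx] t by simp
      have c': "chom Y (f x) (f x) \<in> arrs Q (etype X x) (etype X x)" using c[OF fx] t by simp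
      show ?thesis
      proof
        assume "\<forall>y \<in> carrier Y. u \<cdot> val \<sigma> x \<cdot> chom Y y (f x) \<preceq> val \<tau> y"
        then have "u \<cdot> val \<sigma> x \<cdot> chom Y (f x) (f x) \<preceq> val \<tau> (f x)" using fx by blast
        moreover have "u \<cdot> val \<sigma> x \<cdot> ide Q (etype X x) \<preceq> u \<cdot> val \<sigma> x \<cdot> chom Y (f x) (f x)"
          using cmp_mono[OF leq_refl[OF uv] i uv uv ide_arr[OF etype_obj[OF X x]] c'] .
        ultimately show "u \<cdot> val \<sigma> x \<preceq> val \<tau> (f x)"
          using leq_trans[OF _ _ uv cmp_arr[OF uv c'] v] by (simp add: cmp_ide[OF uv])
      next
        assume le: "u \<cdot> val \<sigma> x \<preceq> val \<tau> (f x)"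
        show "\<forall>y \<in> carrier Y. u \<cdot> val \<sigma> x \<cdot> chom Y y (f x) \<preceq> val \<tau> y"
        proof
          fix y assume y: "y \<in> carrier Y"
          have "u \<cdot> val \<sigma> x \<cdot> chom Y y (f x) \<preceq> val \<tau> (f x) \<cdot> chom Y y (f x)"
            using cmp_mono[OF le leq_refl[OF c[OF y]] uv v c[OF y] c[OF y]] .
          then show "u \<cdot> val \<sigma> x \<cdot> chom Y y (f x) \<preceq> val \<tau> y"
            using leq_trans[OF _ presheaf_act[OF Y \<tau> y fx] cmp_arr[OF uv c[OF y]]
                cmp_arr[OF v c[OF y]] presheaf_val[OF Y \<tau> y]] by blast
        qed
      qed
    qed
    then have "(\<forall>y \<in> carrier Y. u \<cdot> val (direct_image Q X Y f \<sigma>) y \<preceq> val \<tau> y) \<longleftrightarrow>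
        (\<forall>x \<in> carrier X. u \<cdot> val \<sigma> x \<preceq> val \<tau> (f x))"
      using cmp_direct_image_leq_iff[OF X Y f \<sigma> _ u presheaf_val[OF Y \<tau>]] by auto
    then show ?thesis
      using leq_chom_psh_iff[OF Y D \<tau>, of u] leq_chom_psh_iff[OF X \<sigma> I, of u] u
      by (simp add: direct_image_fst[OF \<sigma>] inverse_image_fst[OF \<tau>] inverse_image_val[OF X Y f \<tau>])
  qed
  have l: "?l \<in> arrs Q (fst \<sigma>) (fst \<tau>)" and r: "?r \<in> arrs Q (fst \<sigma>) (fst \<tau>)"
    using chom_psh_arr[OF Y D \<tau>] chom_psh_arr[OF X \<sigma> I]
    by (auto simp: direct_image_fst[OF \<sigma>] inverse_image_fst[OF \<tau>])
  show ?thesis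
    using leq_antisym[OF _ _ l r] iff[OF l] iff[OF r] leq_refl[OF l] leq_refl[OF r] by blast
qed

lemma direct_inverse_image_adjoint:
  assumes X: "qcategory Q X" and Y: "qcategory Q Y" and f: "f \<in> qfunctors Q X Y"
    and \<sigma>: "\<sigma> \<in> PSh X" and \<tau>: "\<tau> \<in> PSh Y"
  shows "cat_le Q (psh Q Y) (direct_image Q X Y f \<sigma>) \<tau> \<longleftrightarrow> cat_le Q (psh Q X) \<sigma> (inverse_image Q X Y f \<tau>)"
  unfolding cat_le_def direct_inverse_image_hom[OF assms]
  by (simp add: etype_psh direct_image_closed[OF X Y f \<sigma>] inverse_image_closed[OF X Y f \<tau>] \<sigma> \<tau>
      direct_image_fst inverse_image_fst)

lemma direct_image_unit:
  assumes X: "qcategory Q X" and Y: "qcategory Q Y" and f: "f \<in> qfunctors Q X Y"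
    and \<sigma>: "\<sigma> \<in> PSh X"
  shows "cat_le Q (psh Q X) \<sigma> (inverse_image Q X Y f (direct_image Q X Y f \<sigma>))"
  using direct_inverse_image_adjoint[OF assms direct_image_closed[OF assms]]
    cat_le_refl[OF qcategory_psh[OF Y] direct_image_closed[OF assms]] by blast

lemma direct_image_functor:
  assumes X: "qcategory Q X" and Y: "qcategory Q Y" and f: "f \<in> qfunctors Q X Y"
  shows "direct_image Q X Y f \<in> qfunctors Q (psh Q X) (psh Q Y)"
proof -
  have "chom (psh Q X) \<sigma> \<sigma>' \<preceq> chom (psh Q Y) (direct_image Q X Y f \<sigma>) (direct_image Q X Y f \<sigma>')"
    if \<sigma>: "\<sigma> \<in> PSh X" and \<sigma>': "\<sigma>' \<in> PSh X" for \<sigma> \<sigma>'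
  proof -
    let ?h = "chom (psh Q X) \<sigma> \<sigma>'"
    note D' = direct_image_closed[OF assms \<sigma>']
    note I = inverse_image_closed[OF assms D']
    have h: "?h \<in> arrs Q (fst \<sigma>) (fst \<sigma>')" using chom_psh_arr[OF X \<sigma> \<sigma>'] .
    have fst: "fst (inverse_image Q X Y f (direct_image Q X Y f \<sigma>')) = fst \<sigma>'"
      by (simp add: inverse_image_fst[OF D'] direct_image_fst[OF \<sigma>'])
    have "?h \<cdot> val \<sigma> x \<preceq> val (inverse_image Q X Y f (direct_image Q X Y f \<sigma>')) x"
      if x: "x \<in> carrier X" for x
    proof (rule leq_trans[OF chom_psh_act[OF X \<sigma> \<sigma>' x] _ cmp_arr[OF h presheaf_val[OF X \<sigma> x]]])
      show "val \<sigma>' x \<preceq> val (inverse_image Q X Y f (direct_image Q X Y f \<sigma>')) x"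
        using direct_image_unit[OF assms \<sigma>'] x unfolding cat_le_psh_iff[OF X \<sigma>' I] by blast
      show "val \<sigma>' x \<in> arrs Q (etype X x) (fst \<sigma>')" using presheaf_val[OF X \<sigma>' x] .
      show "val (inverse_image Q X Y f (direct_image Q X Y f \<sigma>')) x \<in> arrs Q (etype X x) (fst \<sigma>')"
        using presheaf_val[OF X I x] fst by simp
    qed
    then show ?thesis
      unfolding direct_inverse_image_hom[OF assms \<sigma> D']
      using leq_chom_psh_iff[OF X \<sigma> I] h fst by simp
  qed
  then show ?thesis
    unfolding qfunctors_def using direct_image_closed[OF assms]
    by (auto simp: etype_psh direct_image_fst PiE_def) (simp add: direct_image_def)
qed

lemma direct_image_mono:
  assumes "qcategory Q X" "qcategory Q Y" "f \<in> qfunctors Q X Y" "\<sigma> \<in> PSh X" "\<sigma>' \<in> PSh X"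
    and "cat_le Q (psh Q X) \<sigma> \<sigma>'"
  shows "cat_le Q (psh Q Y) (direct_image Q X Y f \<sigma>) (direct_image Q X Y f \<sigma>')"
  using functor_mono[OF qcategory_psh qcategory_psh direct_image_functor] assms by blast

text \<open>
  Both sides have the same upper bounds \<open>\<tau>\<close>, namely those with an identity below \<open>\<tau> (f x)\<close>.
\<close>

lemma direct_image_yoneda:
  assumes X: "qcategory Q X" and Y: "qcategory Q Y" and f: "f \<in> qfunctors Q X Y"
    and x: "x \<in> carrier X"
  shows "direct_image Q X Y f (yoneda Q X x) = yoneda Q Y (f x)"
proof (rule presheaf_eq_by_upper_bounds[OF Y direct_image_closed[OF X Y f yoneda_closed[OF X x]]
      yoneda_closed[OF Y functor_closed[OF f x]]])
  fix \<tau> assume \<tau>: "\<tau> \<in> PSh Y"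
  show "cat_le Q (psh Q Y) (direct_image Q X Y f (yoneda Q X x)) \<tau> \<longleftrightarrow>
      cat_le Q (psh Q Y) (yoneda Q Y (f x)) \<tau>"
    unfolding direct_inverse_image_adjoint[OF X Y f yoneda_closed[OF X x] \<tau>]
      yoneda_le_iff[OF X x inverse_image_closed[OF X Y f \<tau>]]
      yoneda_le_iff[OF Y functor_closed[OF f x] \<tau>]
    by (simp add: inverse_image_fst[OF \<tau>] inverse_image_val[OF X Y f \<tau> x] functor_etype[OF f x])
qed

text \<open>
  Precomposition is evidently functorial, hence so is its left adjoint.
\<close>

lemma direct_image_compose:
  assumes X: "qcategory Q X" and Y: "qcategory Q Y" and Z: "qcategory Q Z"
    and f: "f \<in> qfunctors Q X Y" and g: "g \<in> qfunctors Q Y Z" and \<sigma>: "\<sigma> \<in> PSh X"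
  shows "direct_image Q X Z (compose (carrier X) g f) \<sigma> = direct_image Q Y Z g (direct_image Q X Y f \<sigma>)"
proof -
  note gf = compose_functor[OF X Y Z f g] and D = direct_image_closed[OF X Y f \<sigma>]
  show ?thesis
  proof (rule presheaf_eq_by_upper_bounds[OF Z direct_image_closed[OF X Z gf \<sigma>]
        direct_image_closed[OF Y Z g D]])
    fix \<tau> assume \<tau>: "\<tau> \<in> PSh Z"
    note I = inverse_image_closed[OF Y Z g \<tau>]
    have "inverse_image Q X Z (compose (carrier X) g f) \<tau> = inverse_image Q X Y f (inverse_image Q Y Z g \<tau>)"
      by (rule presheaf_eqI[OF X inverse_image_closed[OF X Z gf \<tau>] inverse_image_closed[OF X Y f I]])
        (simp_all add: inverse_image_fst \<tau> I inverse_image_val[OF X Z gf \<tau>] inverse_image_val[OF X Y f I]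
          inverse_image_val[OF Y Z g \<tau> functor_closed[OF f]] compose_eq)
    then show "cat_le Q (psh Q Z) (direct_image Q X Z (compose (carrier X) g f) \<sigma>) \<tau> \<longleftrightarrow>
        cat_le Q (psh Q Z) (direct_image Q Y Z g (direct_image Q X Y f \<sigma>)) \<tau>"
      unfolding direct_inverse_image_adjoint[OF X Z gf \<sigma> \<tau>] direct_inverse_image_adjoint[OF Y Z g D \<tau>]
        direct_inverse_image_adjoint[OF X Y f \<sigma> I] by simp
  qed
qed

lemma direct_image_id:
  assumes X: "qcategory Q X" and \<sigma>: "\<sigma> \<in> PSh X"
  shows "direct_image Q X X (id_functor X) \<sigma> = \<sigma>"
proof (rule presheaf_eq_by_upper_bounds[OF X direct_image_closed[OF X X id_functor[OF X] \<sigma>] \<sigma>])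
  fix \<tau> assume \<tau>: "\<tau> \<in> PSh X"
  have "inverse_image Q X X (id_functor X) \<tau> = \<tau>"
    by (rule presheaf_eqI[OF X inverse_image_closed[OF X X id_functor[OF X] \<tau>] \<tau>])
      (simp_all add: inverse_image_fst[OF \<tau>] inverse_image_val[OF X X id_functor[OF X] \<tau>],
       simp add: id_functor_def)
  then show "cat_le Q (psh Q X) (direct_image Q X X (id_functor X) \<sigma>) \<tau> \<longleftrightarrow> cat_le Q (psh Q X) \<sigma> \<tau>"
    unfolding direct_inverse_image_adjoint[OF X X id_functor[OF X] \<sigma> \<tau>] by simp
qed

section \<open>Suprema in presheaf categories\<close>

lemma mult_functor:
  assumes X: "qcategory Q X"
  shows "psh_mult Q X \<in> qfunctors Q (psh Q (psh Q X)) (psh Q X)"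
  unfolding psh_mult_def using inverse_image_functor[OF X qcategory_psh[OF X] yoneda_functor[OF X]] .

lemmas mult_closed = functor_closed[OF mult_functor]

lemma mult_fst: "\<Sigma> \<in> PSh (psh Q X) \<Longrightarrow> fst (psh_mult Q X \<Sigma>) = fst \<Sigma>"
  unfolding psh_mult_def using inverse_image_fst .

lemma mult_val:
  assumes X: "qcategory Q X" and "\<Sigma> \<in> PSh (psh Q X)" "x \<in> carrier X"
  shows "val (psh_mult Q X \<Sigma>) x = val \<Sigma> (yoneda Q X x)"
  unfolding psh_mult_def using inverse_image_val[OF X qcategory_psh[OF X] yoneda_functor[OF X]] assms by blast

text \<open>
  Both sides are the largest \<open>u\<close> with \<open>u \<cdot> \<Sigma> (y x) \<preceq> \<tau> x\<close> for all \<open>x\<close>.  For a general presheaf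
  \<open>\<rho>\<close> in place of \<open>y x\<close> the condition follows, because \<open>\<rho> x\<close> is the hom from \<open>y x\<close> to \<open>\<rho>\<close> and
  so acts on \<open>\<Sigma>\<close>.
\<close>

lemma mult_yoneda_hom:
  assumes X: "qcategory Q X" and \<Sigma>: "\<Sigma> \<in> PSh (psh Q X)" and \<tau>: "\<tau> \<in> PSh X"
  shows "chom (psh Q X) (psh_mult Q X \<Sigma>) \<tau> = chom (psh Q (psh Q X)) \<Sigma> (yoneda Q (psh Q X) \<tau>)"
    (is "?l = ?r")
proof -
  note PX = qcategory_psh[OF X]
  note S = mult_closed[OF X \<Sigma>] and Y = yoneda_closed[OF PX \<tau>]
  have iff: "u \<preceq> ?l \<longleftrightarrow> u \<preceq> ?r" if u: "u \<in> arrs Q (fst \<Sigma>) (fst \<tau>)" for u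
  proof -
    have "(\<forall>x \<in> carrier X. u \<cdot> val \<Sigma> (yoneda Q X x) \<preceq> val \<tau> x) \<longleftrightarrow>
        (\<forall>\<rho> \<in> PSh X. u \<cdot> val \<Sigma> \<rho> \<preceq> chom (psh Q X) \<rho> \<tau>)"
    proof (intro iffI ballI)
      fix \<rho> assume \<rho>: "\<rho> \<in> PSh X" and le: "\<forall>x \<in> carrier X. u \<cdot> val \<Sigma> (yoneda Q X x) \<preceq> val \<tau> x"
      note S\<rho> = presheaf_val[OF PX \<Sigma> \<rho>, unfolded etype_psh[OF \<rho>]]
      have "u \<cdot> val \<Sigma> \<rho> \<cdot> val \<rho> x \<preceq> val \<tau> x" if x: "x \<in> carrier X" for x
      proof -
        note y = yoneda_closed[OF X x]
        note \<rho>x = presheaf_val[OF X \<rho> x] and \<tau>x = presheaf_val[OF X \<tau> x]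
        have Sy: "val \<Sigma> (yoneda Q X x) \<in> arrs Q (etype X x) (fst \<Sigma>)"
          using presheaf_val[OF PX \<Sigma> y] by (simp add: etype_psh[OF y] yoneda_simps x)
        have "val \<Sigma> \<rho> \<cdot> val \<rho> x \<preceq> val \<Sigma> (yoneda Q X x)"
          using presheaf_act[OF PX \<Sigma> y \<rho>] by (simp add: yoneda_lemma[OF X x \<rho>])
        then have "u \<cdot> (val \<Sigma> \<rho> \<cdot> val \<rho> x) \<preceq> u \<cdot> val \<Sigma> (yoneda Q X x)"
          using cmp_mono[OF leq_refl[OF u] _ u u cmp_arr[OF S\<rho> \<rho>x] Sy] by blast
        then show ?thesis
          using leq_trans[OF _ bspec[OF le x] cmp_arr[OF u cmp_arr[OF S\<rho> \<rho>x]] cmp_arr[OF u Sy] \<tau>x]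
          by (simp add: cmp_assoc[OF u S\<rho> \<rho>x])
      qed
      then show "u \<cdot> val \<Sigma> \<rho> \<preceq> chom (psh Q X) \<rho> \<tau>"
        using leq_chom_psh_iff[OF X \<rho> \<tau> cmp_arr[OF u S\<rho>]] by blast
    next
      fix x assume x: "x \<in> carrier X" and le: "\<forall>\<rho> \<in> PSh X. u \<cdot> val \<Sigma> \<rho> \<preceq> chom (psh Q X) \<rho> \<tau>"
      then show "u \<cdot> val \<Sigma> (yoneda Q X x) \<preceq> val \<tau> x"
        using yoneda_closed[OF X x] yoneda_lemma[OF X x \<tau>] by force
    qed
    then show ?thesis
      using leq_chom_psh_iff[OF X S \<tau>, of u] leq_chom_psh_iff[OF PX \<Sigma> Y, of u] u
      by (simp add: mult_fst[OF \<Sigma>] mult_val[OF X \<Sigma>] yoneda_simps[OF \<tau>] etype_psh[OF \<tau>])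
  qed
  have l: "?l \<in> arrs Q (fst \<Sigma>) (fst \<tau>)" and r: "?r \<in> arrs Q (fst \<Sigma>) (fst \<tau>)"
    using chom_psh_arr[OF X S \<tau>] chom_psh_arr[OF PX \<Sigma> Y]
    by (simp_all add: mult_fst[OF \<Sigma>] yoneda_simps[OF \<tau>] etype_psh[OF \<tau>])
  show ?thesis
    using leq_antisym[OF _ _ l r] iff[OF l] iff[OF r] leq_refl[OF l] leq_refl[OF r] by blast
qed

lemma mult_yoneda_adjoint:
  assumes X: "qcategory Q X" and \<Sigma>: "\<Sigma> \<in> PSh (psh Q X)" and \<tau>: "\<tau> \<in> PSh X"
  shows "cat_le Q (psh Q X) (psh_mult Q X \<Sigma>) \<tau> \<longleftrightarrow>
    cat_le Q (psh Q (psh Q X)) \<Sigma> (yoneda Q (psh Q X) \<tau>)"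
  unfolding cat_le_def mult_yoneda_hom[OF assms]
  by (simp add: etype_psh mult_closed[OF X \<Sigma>] mult_fst[OF \<Sigma>] yoneda_closed[OF qcategory_psh[OF X] \<tau>]
      yoneda_simps[OF \<tau>] \<Sigma> \<tau>)

lemma mult_yoneda:
  assumes X: "qcategory Q X" and \<sigma>: "\<sigma> \<in> PSh X"
  shows "psh_mult Q X (yoneda Q (psh Q X) \<sigma>) = \<sigma>"
proof -
  note y = yoneda_closed[OF qcategory_psh[OF X] \<sigma>]
  show ?thesis
    by (rule presheaf_eqI[OF X mult_closed[OF X y] \<sigma>])
      (simp_all add: mult_fst[OF y] mult_val[OF X y] yoneda_simps \<sigma> etype_psh yoneda_lemma[OF X])
qed

text \<open>
  By adjunction this is \<open>y\<^sup>! \<cdot> y = 1\<close>, and \<open>y\<^sup>!\<close> is the multiplication.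
\<close>

lemma mult_direct_image_yoneda:
  assumes X: "qcategory Q X" and \<sigma>: "\<sigma> \<in> PSh X"
  shows "psh_mult Q X (direct_image Q X (psh Q X) (yoneda Q X) \<sigma>) = \<sigma>"
proof -
  note PX = qcategory_psh[OF X] and y = yoneda_functor[OF X]
  note D = direct_image_closed[OF X PX y \<sigma>]
  show ?thesis
  proof (rule presheaf_eq_by_upper_bounds[OF X mult_closed[OF X D] \<sigma>])
    fix \<tau> assume \<tau>: "\<tau> \<in> PSh X"
    show "cat_le Q (psh Q X) (psh_mult Q X (direct_image Q X (psh Q X) (yoneda Q X) \<sigma>)) \<tau> \<longleftrightarrow>
        cat_le Q (psh Q X) \<sigma> \<tau>"
      unfolding mult_yoneda_adjoint[OF X D \<tau>]
        direct_inverse_image_adjoint[OF X PX y \<sigma> yoneda_closed[OF PX \<tau>]]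
      using mult_yoneda[OF X \<tau>] by (simp add: psh_mult_def)
  qed
qed

lemma mult_unit:
  assumes X: "qcategory Q X" and \<Sigma>: "\<Sigma> \<in> PSh (psh Q X)"
  shows "cat_le Q (psh Q (psh Q X)) \<Sigma> (yoneda Q (psh Q X) (psh_mult Q X \<Sigma>))"
  using mult_yoneda_adjoint[OF X \<Sigma> mult_closed[OF X \<Sigma>]]
    cat_le_refl[OF qcategory_psh[OF X] mult_closed[OF X \<Sigma>]] by blast

lemma left_adjoint_iff:
  assumes A: "qcategory Q A" and B: "qcategory Q B" and fg: "left_adjoint Q A B f g"
    and a: "a \<in> carrier A" and b: "b \<in> carrier B"
  shows "cat_le Q B (f a) b \<longleftrightarrow> cat_le Q A a (g b)"
proof -
  have f: "f \<in> qfunctors Q A B" and g: "g \<in> qfunctors Q B A"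
    using fg unfolding left_adjoint_def by auto
  note fa = functor_closed[OF f a] and gb = functor_closed[OF g b]
  have unit: "cat_le Q A a (g (f a))" and counit: "cat_le Q B (f (g b)) b"
    using fg a b unfolding left_adjoint_def fun_le_def id_functor_def by (auto simp: compose_eq)
  show ?thesis
    using cat_le_trans[OF A a functor_closed[OF g fa] gb unit functor_mono[OF B A g fa b]]
      cat_le_trans[OF B fa functor_closed[OF f gb] b functor_mono[OF A B f a gb] counit]
    by blast
qed

lemma left_adjoint_mult:
  assumes X: "qcategory Q X"
  shows "left_adjoint Q (psh Q (psh Q X)) (psh Q X) (psh_mult Q X) (yoneda Q (psh Q X))"
proof -
  note PX = qcategory_psh[OF X]
  show ?thesis
    unfolding left_adjoint_def fun_le_def
    using mult_functor[OF X] yoneda_functor[OF PX] mult_unit[OF X] mult_yoneda[OF X] cat_le_refl[OF PX]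
    by (auto simp: id_functor_def compose_eq)
qed

text \<open>
  The description operator in \<open>sup_functor\<close> is well defined here: \<open>s\<close> is a left adjoint, and
  left adjoints into a separated category are unique.
\<close>

lemma sup_functor_psh:
  assumes X: "qcategory Q X"
  shows "sup_functor Q (psh Q X) = psh_mult Q X"
  unfolding sup_functor_def
proof (rule the_equality[where P = "\<lambda>f. left_adjoint Q (psh Q (psh Q X)) (psh Q X) f (yoneda Q (psh Q X))"])
  show "left_adjoint Q (psh Q (psh Q X)) (psh Q X) (psh_mult Q X) (yoneda Q (psh Q X))"
    using left_adjoint_mult[OF X] .
next
  fix f assume adj: "left_adjoint Q (psh Q (psh Q X)) (psh Q X) f (yoneda Q (psh Q X))"
  note PX = qcategory_psh[OF X]
  have f: "f \<in> qfunctors Q (psh Q (psh Q X)) (psh Q X)" using adj unfolding left_adjoint_def by blast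
  show "f = psh_mult Q X"
  proof (rule extensionalityI[OF functor_extensional[OF f] functor_extensional[OF mult_functor[OF X]]])
    fix \<Sigma> assume \<Sigma>: "\<Sigma> \<in> PSh (psh Q X)"
    show "f \<Sigma> = psh_mult Q X \<Sigma>"
      using presheaf_eq_by_upper_bounds[OF X functor_closed[OF f \<Sigma>] mult_closed[OF X \<Sigma>]]
        left_adjoint_iff[OF qcategory_psh[OF PX] PX adj \<Sigma>] mult_yoneda_adjoint[OF X \<Sigma>] by blast
  qed
qed

text \<open>
  Left adjoints preserve suprema.  The right adjoint of \<open>s \<cdot> l\<^sub>!\<close> is \<open>l\<^sup>! \<cdot> y\<close>, that of \<open>l \<cdot> s\<close> is
  \<open>y \<cdot> r\<close>, and these agree since at \<open>\<tau>\<close> and \<open>\<sigma>\<close> they are the two homs of the adjunction.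
  Naturality of \<open>s\<close> is the case \<open>l = f\<^sub>!\<close>, associativity the case \<open>l = s\<close>.
\<close>

lemma left_adjoint_preserves_mult:
  assumes X: "qcategory Q X" and Y: "qcategory Q Y"
    and l: "l \<in> qfunctors Q (psh Q X) (psh Q Y)" and r: "r \<in> qfunctors Q (psh Q Y) (psh Q X)"
    and hom: "\<And>\<sigma> \<tau>. \<lbrakk>\<sigma> \<in> PSh X; \<tau> \<in> PSh Y\<rbrakk> \<Longrightarrow> chom (psh Q Y) (l \<sigma>) \<tau> = chom (psh Q X) \<sigma> (r \<tau>)"
    and \<Sigma>: "\<Sigma> \<in> PSh (psh Q X)"
  shows "psh_mult Q Y (direct_image Q (psh Q X) (psh Q Y) l \<Sigma>) = l (psh_mult Q X \<Sigma>)"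
proof -
  note PX = qcategory_psh[OF X] and PY = qcategory_psh[OF Y]
  note D = direct_image_closed[OF PX PY l \<Sigma>] and S = mult_closed[OF X \<Sigma>]
  show ?thesis
  proof (rule presheaf_eq_by_upper_bounds[OF Y mult_closed[OF Y D] functor_closed[OF l S]])
    fix \<tau> assume \<tau>: "\<tau> \<in> PSh Y"
    note y = yoneda_closed[OF PY \<tau>] and r\<tau> = functor_closed[OF r \<tau>]
    note I = inverse_image_closed[OF PX PY l y]
    have fst_r: "fst (r \<tau>) = fst \<tau>" using functor_etype[OF r \<tau>] by (simp add: etype_psh \<tau> r\<tau>)
    have fst_l: "fst (l (psh_mult Q X \<Sigma>)) = fst (psh_mult Q X \<Sigma>)"
      using functor_etype[OF l S] by (simp add: etype_psh S functor_closed[OF l S])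
    have eq: "inverse_image Q (psh Q X) (psh Q Y) l (yoneda Q (psh Q Y) \<tau>) = yoneda Q (psh Q X) (r \<tau>)"
      by (rule presheaf_eqI[OF PX I yoneda_closed[OF PX r\<tau>]])
        (simp_all add: inverse_image_fst[OF y] inverse_image_val[OF PX PY l y] yoneda_simps \<tau> r\<tau>
          etype_psh fst_r hom)
    have "cat_le Q (psh Q Y) (l (psh_mult Q X \<Sigma>)) \<tau> \<longleftrightarrow> cat_le Q (psh Q X) (psh_mult Q X \<Sigma>) (r \<tau>)"
      unfolding cat_le_def hom[OF S \<tau>]
      by (simp add: etype_psh S \<tau> r\<tau> functor_closed[OF l S] fst_r fst_l)
    then show "cat_le Q (psh Q Y) (psh_mult Q Y (direct_image Q (psh Q X) (psh Q Y) l \<Sigma>)) \<tau> \<longleftrightarrow>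
        cat_le Q (psh Q Y) (l (psh_mult Q X \<Sigma>)) \<tau>"
      unfolding mult_yoneda_adjoint[OF Y D \<tau>] direct_inverse_image_adjoint[OF PX PY l \<Sigma> y] eq
        mult_yoneda_adjoint[OF X \<Sigma> r\<tau>] by simp
  qed
qed

lemma mult_natural:
  assumes X: "qcategory Q X" and Y: "qcategory Q Y" and f: "f \<in> qfunctors Q X Y"
    and \<Sigma>: "\<Sigma> \<in> PSh (psh Q X)"
  shows "psh_mult Q Y (direct_image Q (psh Q X) (psh Q Y) (direct_image Q X Y f) \<Sigma>) =
    direct_image Q X Y f (psh_mult Q X \<Sigma>)"
  using left_adjoint_preserves_mult[OF X Y direct_image_functor[OF X Y f] inverse_image_functor[OF X Y f]
      direct_inverse_image_hom[OF X Y f] \<Sigma>] .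

lemma mult_assoc:
  assumes X: "qcategory Q X" and \<Theta>: "\<Theta> \<in> PSh (psh Q (psh Q X))"
  shows "psh_mult Q X (direct_image Q (psh Q (psh Q X)) (psh Q X) (psh_mult Q X) \<Theta>) =
    psh_mult Q X (psh_mult Q (psh Q X) \<Theta>)"
  using left_adjoint_preserves_mult[OF qcategory_psh[OF X] X mult_functor[OF X]
      yoneda_functor[OF qcategory_psh[OF X]] mult_yoneda_hom[OF X] \<Theta>] .

text \<open>
  An arbitrary functor preserves suprema laxly.  By the two adjunctions the claim is
  \<open>\<Sigma> \<sigma> \<preceq> P Y (c \<sigma>) (c (s \<Sigma>))\<close>, and \<open>\<Sigma> \<sigma> \<preceq> P X \<sigma> (s \<Sigma>)\<close> is the unit of \<open>s -| y\<close>.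
\<close>

lemma functor_mult_le:
  assumes X: "qcategory Q X" and Y: "qcategory Q Y" and c: "c \<in> qfunctors Q (psh Q X) (psh Q Y)"
    and \<Sigma>: "\<Sigma> \<in> PSh (psh Q X)"
  shows "cat_le Q (psh Q Y) (psh_mult Q Y (direct_image Q (psh Q X) (psh Q Y) c \<Sigma>)) (c (psh_mult Q X \<Sigma>))"
proof -
  note PX = qcategory_psh[OF X] and PY = qcategory_psh[OF Y]
  note D = direct_image_closed[OF PX PY c \<Sigma>] and S = mult_closed[OF X \<Sigma>]
  note cS = functor_closed[OF c S]
  note y = yoneda_closed[OF PY cS]
  note I = inverse_image_closed[OF PX PY c y]
  have fst: "fst (c (psh_mult Q X \<Sigma>)) = fst \<Sigma>"
    using functor_etype[OF c S] by (simp add: etype_psh S cS mult_fst[OF \<Sigma>])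
  have "val \<Sigma> \<sigma> \<preceq> chom (psh Q Y) (c \<sigma>) (c (psh_mult Q X \<Sigma>))" if \<sigma>: "\<sigma> \<in> PSh X" for \<sigma>
  proof (rule leq_trans[OF _ functor_chom[OF c \<sigma> S]])
    show "val \<Sigma> \<sigma> \<preceq> chom (psh Q X) \<sigma> (psh_mult Q X \<Sigma>)"
      using mult_unit[OF X \<Sigma>] \<sigma> unfolding cat_le_psh_iff[OF PX \<Sigma> yoneda_closed[OF PX S]]
      by (simp add: yoneda_simps S)
    show "val \<Sigma> \<sigma> \<in> arrs Q (fst \<sigma>) (fst \<Sigma>)"
      using presheaf_val[OF PX \<Sigma> \<sigma>] by (simp add: etype_psh[OF \<sigma>])
    show "chom (psh Q X) \<sigma> (psh_mult Q X \<Sigma>) \<in> arrs Q (fst \<sigma>) (fst \<Sigma>)"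
      using chom_psh_arr[OF X \<sigma> S] by (simp add: mult_fst[OF \<Sigma>])
    show "chom (psh Q Y) (c \<sigma>) (c (psh_mult Q X \<Sigma>)) \<in> arrs Q (fst \<sigma>) (fst \<Sigma>)"
      using chom_psh_arr[OF Y functor_closed[OF c \<sigma>] cS] functor_etype[OF c \<sigma>] fst
      by (simp add: etype_psh \<sigma> functor_closed[OF c \<sigma>])
  qed
  then show ?thesis
    unfolding mult_yoneda_adjoint[OF Y D cS] direct_inverse_image_adjoint[OF PX PY c \<Sigma> y]
      cat_le_psh_iff[OF PX \<Sigma> I]
    by (simp add: inverse_image_fst[OF y] inverse_image_val[OF PX PY c y] yoneda_simps cS etype_psh fst)
qed

section \<open>The distributive law\<close>

lemma law_eq:
  assumes X: "qcategory Q X" and \<Sigma>: "\<Sigma> \<in> PSh (psh Q X)"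
  shows "yoneda_sup_law Q X \<Sigma> = yoneda Q (psh Q X) (psh_mult Q X \<Sigma>)"
  unfolding yoneda_sup_law_def sup_functor_psh[OF X] using \<Sigma> by (simp add: compose_eq)

lemma law_functor:
  assumes X: "qcategory Q X"
  shows "yoneda_sup_law Q X \<in> qfunctors Q (psh Q (psh Q X)) (psh Q (psh Q X))"
proof -
  note PX = qcategory_psh[OF X]
  note PPX = qcategory_psh[OF PX]
  show ?thesis
    unfolding yoneda_sup_law_def sup_functor_psh[OF X]
    using compose_functor[OF PPX PX PPX mult_functor[OF X] yoneda_functor[OF PX]] .
qed

lemma law_flat:
  assumes X: "qcategory Q X" and \<sigma>: "\<sigma> \<in> PSh X"
  shows "yoneda_sup_law Q X (direct_image Q X (psh Q X) (yoneda Q X) \<sigma>) = yoneda Q (psh Q X) \<sigma>"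
  using law_eq[OF X direct_image_closed[OF X qcategory_psh[OF X] yoneda_functor[OF X] \<sigma>]]
    mult_direct_image_yoneda[OF X \<sigma>] by simp

lemma law_natural:
  assumes X: "qcategory Q X" and Y: "qcategory Q Y" and f: "f \<in> qfunctors Q X Y"
    and \<Sigma>: "\<Sigma> \<in> PSh (psh Q X)"
  shows "direct_image Q (psh Q X) (psh Q Y) (direct_image Q X Y f) (yoneda_sup_law Q X \<Sigma>) =
    yoneda_sup_law Q Y (direct_image Q (psh Q X) (psh Q Y) (direct_image Q X Y f) \<Sigma>)"
proof -
  note PX = qcategory_psh[OF X] and PY = qcategory_psh[OF Y] and Pf = direct_image_functor[OF X Y f]
  show ?thesis
    unfolding law_eq[OF X \<Sigma>] law_eq[OF Y direct_image_closed[OF PX PY Pf \<Sigma>]]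
      direct_image_yoneda[OF PX PY Pf mult_closed[OF X \<Sigma>]] mult_natural[OF X Y f \<Sigma>] ..
qed

text \<open>
  Both sides are \<open>y \<cdot> s \<cdot> s\<close>: on the left the inner \<open>y\<close> is moved out by naturality and cancelled by
  the outer multiplication, on the right associativity is used.
\<close>

lemma law_sup:
  assumes X: "qcategory Q X" and \<Theta>: "\<Theta> \<in> PSh (psh Q (psh Q X))"
  shows "psh_mult Q (psh Q X) (direct_image Q (psh Q (psh Q X)) (psh Q (psh Q X)) (yoneda_sup_law Q X)
      (yoneda_sup_law Q (psh Q X) \<Theta>)) =
    yoneda_sup_law Q X (direct_image Q (psh Q (psh Q X)) (psh Q X) (psh_mult Q X) \<Theta>)"
proof -
  note PX = qcategory_psh[OF X]
  note PPX = qcategory_psh[OF PX]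
  note S = mult_closed[OF PX \<Theta>] and L = law_functor[OF X]
  show ?thesis
    unfolding law_eq[OF PX \<Theta>] direct_image_yoneda[OF PPX PPX L S]
      mult_yoneda[OF PX functor_closed[OF L S]]
    unfolding law_eq[OF X S] law_eq[OF X direct_image_closed[OF PPX PX mult_functor[OF X] \<Theta>]] mult_assoc[OF X \<Theta>] ..
qed

lemma direct_image_yoneda_le:
  assumes X: "qcategory Q X" and \<sigma>: "\<sigma> \<in> PSh X"
  shows "cat_le Q (psh Q (psh Q X)) (direct_image Q X (psh Q X) (yoneda Q X) \<sigma>) (yoneda Q (psh Q X) \<sigma>)"
  using mult_unit[OF X direct_image_closed[OF X qcategory_psh[OF X] yoneda_functor[OF X] \<sigma>]]
    mult_direct_image_yoneda[OF X \<sigma>] by simp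

lemma law_yoneda:
  assumes X: "qcategory Q X" and \<sigma>: "\<sigma> \<in> PSh X"
  shows "yoneda_sup_law Q X (yoneda Q (psh Q X) \<sigma>) = yoneda Q (psh Q X) \<sigma>"
  unfolding law_eq[OF X yoneda_closed[OF qcategory_psh[OF X] \<sigma>]] mult_yoneda[OF X \<sigma>] ..

text \<open>
  Naturality of \<open>y\<close> reduces the claim to \<open>s \<cdot> s \<cdot> \<lambda>\<^sub>! = s \<cdot> s\<close>.  By associativity the left side is
  \<open>s \<cdot> s\<^sub>! \<cdot> \<lambda>\<^sub>! = s \<cdot> (s \<cdot> \<lambda>)\<^sub>!\<close>, and \<open>s \<cdot> \<lambda> = s \<cdot> y \<cdot> s = s\<close>.
\<close>

lemma law_mult:
  assumes X: "qcategory Q X" and \<Theta>: "\<Theta> \<in> PSh (psh Q (psh Q X))"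
  shows "direct_image Q (psh Q (psh Q X)) (psh Q X) (psh_mult Q X)
      (yoneda_sup_law Q (psh Q X)
        (direct_image Q (psh Q (psh Q X)) (psh Q (psh Q X)) (yoneda_sup_law Q X) \<Theta>)) =
    yoneda_sup_law Q X (psh_mult Q (psh Q X) \<Theta>)"
proof -
  note PX = qcategory_psh[OF X]
  note PPX = qcategory_psh[OF PX]
  note L = law_functor[OF X] and m = mult_functor[OF X]
  note D = direct_image_closed[OF PPX PPX L \<Theta>]
  note S = mult_closed[OF PX D]
  have "compose (PSh (psh Q X)) (psh_mult Q X) (yoneda_sup_law Q X) = psh_mult Q X"
  proof (rule extensionalityI[OF compose_extensional functor_extensional[OF m]])
    fix \<Sigma> assume \<Sigma>: "\<Sigma> \<in> PSh (psh Q X)"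
    then show "compose (PSh (psh Q X)) (psh_mult Q X) (yoneda_sup_law Q X) \<Sigma> = psh_mult Q X \<Sigma>"
      by (simp add: compose_eq law_eq[OF X \<Sigma>] mult_yoneda[OF X mult_closed[OF X \<Sigma>]])
  qed
  then have "direct_image Q (psh Q (psh Q X)) (psh Q X) (psh_mult Q X)
      (direct_image Q (psh Q (psh Q X)) (psh Q (psh Q X)) (yoneda_sup_law Q X) \<Theta>) =
    direct_image Q (psh Q (psh Q X)) (psh Q X) (psh_mult Q X) \<Theta>"
    using direct_image_compose[OF PPX PPX PX L m \<Theta>] by simp
  then have "psh_mult Q X (psh_mult Q (psh Q X)
      (direct_image Q (psh Q (psh Q X)) (psh Q (psh Q X)) (yoneda_sup_law Q X) \<Theta>)) =
    psh_mult Q X (psh_mult Q (psh Q X) \<Theta>)"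
    using mult_assoc[OF X D] mult_assoc[OF X \<Theta>] by simp
  then show ?thesis
    unfolding law_eq[OF PX D] direct_image_yoneda[OF PPX PX m S] law_eq[OF X mult_closed[OF PX \<Theta>]]
    by simp
qed

lemma flat_yoneda_sup_law: "flat_law Q (yoneda_sup_law Q)"
  unfolding flat_law_def
proof (intro allI impI)
  fix X :: "('o, 'a, 'x) qcat" assume X: "qcategory Q X"
  show "yoneda Q (psh Q X) = compose (PSh X) (yoneda_sup_law Q X) (direct_image Q X (psh Q X) (yoneda Q X))"
    by (rule extensionalityI[OF functor_extensional[OF yoneda_functor[OF qcategory_psh[OF X]]]
          compose_extensional]) (simp add: compose_eq law_flat[OF X])
qed

lemma distributive_yoneda_sup_law:
  "distributive_law Q (yoneda_sup_law Q) (yoneda_sup_law Q) (yoneda_sup_law Q)"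
proof -
  have components: "law_components Q (yoneda_sup_law Q)"
    unfolding law_components_def using law_functor by blast
  show ?thesis
    unfolding distributive_law_def Let_def fun_le_def
  proof (intro conjI allI impI ballI components)
    fix X :: "('o, 'a, 'x) qcat" and Y :: "('o, 'a, 'y) qcat" and f \<Sigma>
    assume X: "qcategory Q X" and Y: "qcategory Q Y" and f: "f \<in> qfunctors Q X Y"
      and \<Sigma>: "\<Sigma> \<in> PSh (psh Q X)"
    note PX = qcategory_psh[OF X] and PY = qcategory_psh[OF Y]
    show "cat_le Q (psh Q (psh Q Y))
        (compose (PSh (psh Q X)) (direct_image Q (psh Q X) (psh Q Y) (direct_image Q X Y f))
          (yoneda_sup_law Q X) \<Sigma>)
        (compose (PSh (psh Q X)) (yoneda_sup_law Q Y)
          (direct_image Q (psh Q X) (psh Q Y) (direct_image Q X Y f)) \<Sigma>)"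
      using cat_le_refl[OF qcategory_psh[OF PY] functor_closed[OF law_functor[OF Y]
            direct_image_closed[OF PX PY direct_image_functor[OF X Y f] \<Sigma>]]]
      by (simp add: compose_eq \<Sigma> law_natural[OF X Y f \<Sigma>])
  next
    fix X :: "('o, 'a, 'x) qcat" and \<sigma> assume X: "qcategory Q X" and \<sigma>: "\<sigma> \<in> PSh X"
    note PX = qcategory_psh[OF X]
    note y_refl = cat_le_refl[OF qcategory_psh[OF PX] yoneda_closed[OF PX \<sigma>]]
    show "cat_le Q (psh Q (psh Q X)) (yoneda Q (psh Q X) \<sigma>)
        (compose (PSh X) (yoneda_sup_law Q X) (direct_image Q X (psh Q X) (yoneda Q X)) \<sigma>)"
      using y_refl by (simp add: compose_eq \<sigma> law_flat[OF X \<sigma>])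
    show "cat_le Q (psh Q (psh Q X)) (direct_image Q X (psh Q X) (yoneda Q X) \<sigma>)
        (compose (PSh X) (yoneda_sup_law Q X) (yoneda Q (psh Q X)) \<sigma>)"
      using direct_image_yoneda_le[OF X \<sigma>] by (simp add: compose_eq \<sigma> law_yoneda[OF X \<sigma>])
  next
    fix X :: "('o, 'a, 'x) qcat" and \<Theta>
    assume X: "qcategory Q X" and \<Theta>: "\<Theta> \<in> PSh (psh Q (psh Q X))"
    note PX = qcategory_psh[OF X]
    note PPX = qcategory_psh[OF PX]
    note L = functor_closed[OF law_functor[OF X]]
    show "cat_le Q (psh Q (psh Q X))
        (compose (PSh (psh Q (psh Q X))) (psh_mult Q (psh Q X))
          (compose (PSh (psh Q (psh Q X)))
            (direct_image Q (psh Q (psh Q X)) (psh Q (psh Q X)) (yoneda_sup_law Q X))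
            (yoneda_sup_law Q (psh Q X))) \<Theta>)
        (compose (PSh (psh Q (psh Q X))) (yoneda_sup_law Q X)
          (direct_image Q (psh Q (psh Q X)) (psh Q X) (psh_mult Q X)) \<Theta>)"
      using cat_le_refl[OF PPX L[OF direct_image_closed[OF PPX PX mult_functor[OF X] \<Theta>]]]
      by (simp add: compose_eq \<Theta> law_sup[OF X \<Theta>])
    show "cat_le Q (psh Q (psh Q X))
        (compose (PSh (psh Q (psh Q X))) (direct_image Q (psh Q (psh Q X)) (psh Q X) (psh_mult Q X))
          (compose (PSh (psh Q (psh Q X))) (yoneda_sup_law Q (psh Q X))
            (direct_image Q (psh Q (psh Q X)) (psh Q (psh Q X)) (yoneda_sup_law Q X))) \<Theta>)
        (compose (PSh (psh Q (psh Q X))) (yoneda_sup_law Q X) (psh_mult Q (psh Q X)) \<Theta>)"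
      using cat_le_refl[OF PPX L[OF mult_closed[OF PX \<Theta>]]]
      by (simp add: compose_eq \<Theta> law_mult[OF X \<Theta>])
  qed
qed

section \<open>Lax algebras are closure spaces\<close>

text \<open>
  With \<open>\<sigma> x\<close> read as the hom from \<open>y x\<close> to \<open>\<sigma>\<close>, functoriality gives \<open>\<sigma> x \<preceq> P X (p (y x)) (p \<sigma>)\<close>,
  and \<open>y x \<le> p (y x)\<close> gives \<open>P X (p (y x)) (p \<sigma>) \<preceq> P X (y x) (p \<sigma>) = p \<sigma> x\<close>.
\<close>

lemma yoneda_le_imp_inflationary:
  assumes X: "qcategory Q X" and p: "p \<in> qfunctors Q (psh Q X) (psh Q X)"
    and y: "\<And>x. x \<in> carrier X \<Longrightarrow> cat_le Q (psh Q X) (yoneda Q X x) (p (yoneda Q X x))"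
    and \<sigma>: "\<sigma> \<in> PSh X"
  shows "cat_le Q (psh Q X) \<sigma> (p \<sigma>)"
proof -
  note PX = qcategory_psh[OF X] and p\<sigma> = functor_closed[OF p \<sigma>]
  have fst: "fst (p \<sigma>) = fst \<sigma>"
    using functor_etype[OF p \<sigma>] by (simp add: etype_psh \<sigma> p\<sigma>)
  have "val \<sigma> x \<preceq> val (p \<sigma>) x" if x: "x \<in> carrier X" for x
  proof -
    let ?y = "yoneda Q X x" and ?i = "ide Q (etype X x)"
    note yx = yoneda_closed[OF X x]
    note py = functor_closed[OF p yx]
    note i = ide_arr[OF etype_obj[OF X x]]
    have t: "fst ?y = etype X x" "fst (p ?y) = etype X x"
      using functor_etype[OF p yx] by (simp_all add: etype_psh yx py yoneda_simps x)
    let ?h = "chom (psh Q X) (p ?y) (p \<sigma>)" and ?k = "chom (psh Q X) ?y (p ?y)"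
    have h: "?h \<in> arrs Q (etype X x) (fst \<sigma>)" using chom_psh_arr[OF X py p\<sigma>] t fst by simp
    have k: "?k \<in> arrs Q (etype X x) (etype X x)" using chom_psh_arr[OF X yx py] t by simp
    note v = presheaf_val[OF X \<sigma> x]
    have v': "val (p \<sigma>) x \<in> arrs Q (etype X x) (fst \<sigma>)" using presheaf_val[OF X p\<sigma> x] fst by simp
    have "val \<sigma> x \<preceq> ?h"
      using functor_chom[OF p yx \<sigma>] by (simp add: yoneda_lemma[OF X x \<sigma>])
    moreover have "?i \<preceq> ?k"
      using y[OF x] unfolding cat_le_def etype_psh[OF yx] t by blast
    ultimately have "val \<sigma> x \<cdot> ?i \<preceq> ?h \<cdot> ?k" using cmp_mono[OF _ _ v h i k] by blast
    moreover have "?h \<cdot> ?k \<preceq> val (p \<sigma>) x"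
      using chom_cmp[OF PX yx py p\<sigma>] by (simp add: yoneda_lemma[OF X x p\<sigma>])
    ultimately show ?thesis
      using leq_trans[OF _ _ v cmp_arr[OF h k] v'] by (simp add: cmp_ide[OF v])
  qed
  then show ?thesis unfolding cat_le_psh_iff[OF X \<sigma> p\<sigma>] using fst by simp
qed

text \<open>
  The associativity condition of a lax algebra contains \<open>s \<cdot> p\<^sub>! \<cdot> y\<close>, which is \<open>p\<close> by naturality.
\<close>

lemma lax_algebra_iff:
  assumes X: "qcategory Q X" and p: "p \<in> qfunctors Q (psh Q X) (psh Q X)"
  shows "lax_algebra Q (yoneda_sup_law Q) (X, p) \<longleftrightarrow>
    (\<forall>x \<in> carrier X. cat_le Q (psh Q X) (yoneda Q X x) (p (yoneda Q X x))) \<and>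
    (\<forall>\<Sigma> \<in> PSh (psh Q X). cat_le Q (psh Q X)
      (p (psh_mult Q X (direct_image Q (psh Q X) (psh Q X) p \<Sigma>))) (p (psh_mult Q X \<Sigma>)))"
proof -
  note PX = qcategory_psh[OF X]
  have "psh_mult Q X (direct_image Q (psh Q X) (psh Q X) p
      (yoneda_sup_law Q X (direct_image Q (psh Q X) (psh Q X) p \<Sigma>))) =
    p (psh_mult Q X (direct_image Q (psh Q X) (psh Q X) p \<Sigma>))" if \<Sigma>: "\<Sigma> \<in> PSh (psh Q X)" for \<Sigma>
  proof -
    note D = direct_image_closed[OF PX PX p \<Sigma>]
    note S = mult_closed[OF X D]
    show ?thesis
      unfolding law_eq[OF X D] direct_image_yoneda[OF PX PX p S] mult_yoneda[OF X functor_closed[OF p S]] ..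
  qed
  then show ?thesis
    unfolding lax_algebra_def Let_def fun_le_def using X p by (simp add: compose_eq)
qed

lemma closure_space_iff:
  assumes X: "qcategory Q X" and p: "p \<in> qfunctors Q (psh Q X) (psh Q X)"
  shows "closure_space Q (X, p) \<longleftrightarrow>
    (\<forall>\<sigma> \<in> PSh X. cat_le Q (psh Q X) \<sigma> (p \<sigma>)) \<and> (\<forall>\<sigma> \<in> PSh X. p (p \<sigma>) = p \<sigma>)"
proof -
  have "compose (PSh X) p p = p \<longleftrightarrow> (\<forall>\<sigma> \<in> PSh X. p (p \<sigma>) = p \<sigma>)"
  proof
    assume "compose (PSh X) p p = p"
    then show "\<forall>\<sigma> \<in> PSh X. p (p \<sigma>) = p \<sigma>" by (metis compose_eq)
  next
    assume "\<forall>\<sigma> \<in> PSh X. p (p \<sigma>) = p \<sigma>"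
    then show "compose (PSh X) p p = p"
      by (intro extensionalityI[OF compose_extensional functor_extensional[OF p]]) (simp add: compose_eq)
  qed
  then show ?thesis
    unfolding closure_space_def Let_def fun_le_def id_functor_def using X p by simp
qed

lemma lax_algebra_eq_closure_space: "lax_algebra Q (yoneda_sup_law Q) A \<longleftrightarrow> closure_space Q A"
proof -
  obtain X p where A: "A = (X, p)" by (cases A)
  show ?thesis
  proof (cases "qcategory Q X \<and> p \<in> qfunctors Q (psh Q X) (psh Q X)")
    case False
    then show ?thesis unfolding A lax_algebra_def closure_space_def Let_def by auto
  next
    case True
    then have X: "qcategory Q X" and p: "p \<in> qfunctors Q (psh Q X) (psh Q X)" by auto
    note PX = qcategory_psh[OF X] and pcl = functor_closed[OF p]
    show ?thesis
      unfolding A lax_algebra_iff[OF X p] closure_space_iff[OF X p]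
    proof (intro iffI conjI ballI; elim conjE)
      assume unit: "\<forall>x \<in> carrier X. cat_le Q (psh Q X) (yoneda Q X x) (p (yoneda Q X x))"
        and mult: "\<forall>\<Sigma> \<in> PSh (psh Q X). cat_le Q (psh Q X)
          (p (psh_mult Q X (direct_image Q (psh Q X) (psh Q X) p \<Sigma>))) (p (psh_mult Q X \<Sigma>))"
      fix \<sigma> assume \<sigma>: "\<sigma> \<in> PSh X"
      show infl: "cat_le Q (psh Q X) \<sigma> (p \<sigma>)"
        using yoneda_le_imp_inflationary[OF X p _ \<sigma>] unit by blast
      \<comment> \<open>the associativity condition at the representable presheaf of \<open>\<sigma>\<close>\<close>
      have "cat_le Q (psh Q X) (p (p \<sigma>)) (p \<sigma>)"
        using bspec[OF mult yoneda_closed[OF PX \<sigma>]]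
        by (simp add: direct_image_yoneda[OF PX PX p \<sigma>] mult_yoneda[OF X] \<sigma> pcl)
      then show "p (p \<sigma>) = p \<sigma>"
        using psh_separated[OF X pcl[OF pcl[OF \<sigma>]] pcl[OF \<sigma>]]
          functor_mono[OF PX PX p \<sigma> pcl[OF \<sigma>] infl] by blast
    next
      assume infl: "\<forall>\<sigma> \<in> PSh X. cat_le Q (psh Q X) \<sigma> (p \<sigma>)"
      fix x assume "x \<in> carrier X"
      then show "cat_le Q (psh Q X) (yoneda Q X x) (p (yoneda Q X x))"
        using infl yoneda_closed[OF X] by blast
    next
      assume idem: "\<forall>\<sigma> \<in> PSh X. p (p \<sigma>) = p \<sigma>"
      fix \<Sigma> assume \<Sigma>: "\<Sigma> \<in> PSh (psh Q X)"
      note S = mult_closed[OF X \<Sigma>]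
      note S' = mult_closed[OF X direct_image_closed[OF PX PX p \<Sigma>]]
      show "cat_le Q (psh Q X)
          (p (psh_mult Q X (direct_image Q (psh Q X) (psh Q X) p \<Sigma>))) (p (psh_mult Q X \<Sigma>))"
        using functor_mono[OF PX PX p S' pcl[OF S] functor_mult_le[OF X X p \<Sigma>]] idem S by simp
    qed
  qed
qed

section \<open>Equality of the two 2-categories\<close>

lemma continuous_iff:
  assumes c: "c \<in> qfunctors Q (psh Q X) (psh Q X)"
  shows "f \<in> continuous_functors Q (X, c) (Y, d) \<longleftrightarrow> f \<in> qfunctors Q X Y \<and>
    (\<forall>\<sigma> \<in> PSh X. cat_le Q (psh Q Y) (direct_image Q X Y f (c \<sigma>)) (d (direct_image Q X Y f \<sigma>)))"
  unfolding continuous_functors_def fun_le_def by (simp add: compose_eq)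

lemma two_category_Cls: "two_category (Cls Q)"
proof -
  have cls: "qcategory Q (fst A)" "snd A \<in> qfunctors Q (psh Q (fst A)) (psh Q (fst A))"
    if "A \<in> ob (Cls Q)" for A
    using that unfolding Cls_def closure_space_def by (auto simp: Let_def split_beta)
  have cont: "f \<in> mor (Cls Q) A B \<longleftrightarrow> f \<in> qfunctors Q (fst A) (fst B) \<and>
      (\<forall>\<sigma> \<in> PSh (fst A). cat_le Q (psh Q (fst B)) (direct_image Q (fst A) (fst B) f (snd A \<sigma>))
        (snd B (direct_image Q (fst A) (fst B) f \<sigma>)))"
    if "A \<in> ob (Cls Q)" for A B f
    using continuous_iff[OF cls(2)[OF that], of f "fst B" "snd B"] by (simp add: Cls_def)
  have unit: "unit_mor (Cls Q) A = id_functor (fst A)"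
    and comp: "comp_mor (Cls Q) A B D g f = compose (carrier (fst A)) g f"
    and le: "le_mor (Cls Q) A B f f' \<longleftrightarrow> fun_le Q (fst A) (fst B) f f'" for A B D f f' g
    by (simp_all add: Cls_def)
  show ?thesis
    unfolding two_category_def unit comp le
  proof (intro conjI ballI impI)
    fix A assume A: "A \<in> ob (Cls Q)"
    note X = cls[OF A]
    show "id_functor (fst A) \<in> mor (Cls Q) A A"
      unfolding cont[OF A] using id_functor[OF X(1)]
      by (simp add: direct_image_id[OF X(1)] functor_closed[OF X(2)] cat_le_refl[OF qcategory_psh[OF X(1)]])
  next
    fix A B D f g
    assume A: "A \<in> ob (Cls Q)" and B: "B \<in> ob (Cls Q)" and D: "D \<in> ob (Cls Q)"
      and f: "f \<in> mor (Cls Q) A B" and g: "g \<in> mor (Cls Q) B D"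
    note X = cls[OF A] and Y = cls[OF B] and Z = cls[OF D]
    note PZ = qcategory_psh[OF Z(1)]
    have ff: "f \<in> qfunctors Q (fst A) (fst B)" and gf: "g \<in> qfunctors Q (fst B) (fst D)"
      using f g cont A B by blast+
    let ?f = "direct_image Q (fst A) (fst B) f" and ?g = "direct_image Q (fst B) (fst D) g"
    have "cat_le Q (psh Q (fst D)) (?g (?f (snd A \<sigma>))) (snd D (?g (?f \<sigma>)))" if \<sigma>: "\<sigma> \<in> PSh (fst A)" for \<sigma>
    proof -
      note c\<sigma> = functor_closed[OF X(2) \<sigma>] and f\<sigma> = direct_image_closed[OF X(1) Y(1) ff \<sigma>]
      note fc\<sigma> = direct_image_closed[OF X(1) Y(1) ff c\<sigma>]
      note df\<sigma> = functor_closed[OF Y(2) f\<sigma>]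
      note g_cl = direct_image_closed[OF Y(1) Z(1) gf]
      have 1: "cat_le Q (psh Q (fst D)) (?g (?f (snd A \<sigma>))) (?g (snd B (?f \<sigma>)))"
        using direct_image_mono[OF Y(1) Z(1) gf fc\<sigma> df\<sigma>] f \<sigma> unfolding cont[OF A] by blast
      have 2: "cat_le Q (psh Q (fst D)) (?g (snd B (?f \<sigma>))) (snd D (?g (?f \<sigma>)))"
        using g f\<sigma> unfolding cont[OF B] by blast
      show ?thesis
        using cat_le_trans[OF PZ g_cl[OF fc\<sigma>] g_cl[OF df\<sigma>] functor_closed[OF Z(2) g_cl[OF f\<sigma>]] 1 2] .
    qed
    then show "compose (carrier (fst A)) g f \<in> mor (Cls Q) A D"
      unfolding cont[OF A] using compose_functor[OF X(1) Y(1) Z(1) ff gf]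
      by (simp add: direct_image_compose[OF X(1) Y(1) Z(1) ff gf] functor_closed[OF X(2)])
  next
    fix A B f assume A: "A \<in> ob (Cls Q)" and B: "B \<in> ob (Cls Q)" and f: "f \<in> mor (Cls Q) A B"
    have ff: "f \<in> qfunctors Q (fst A) (fst B)" using f cont A by blast
    note ext = extensionalityI[OF compose_extensional functor_extensional[OF ff]]
    show "compose (carrier (fst A)) f (id_functor (fst A)) = f"
      by (rule ext) (simp add: compose_eq id_functor_def)
    show "compose (carrier (fst A)) (id_functor (fst B)) f = f"
      by (rule ext) (simp add: compose_eq id_functor_def functor_closed[OF ff])
    show "fun_le Q (fst A) (fst B) f f"
      unfolding fun_le_def using cat_le_refl[OF cls(1)[OF B]] functor_closed[OF ff] by blast
  next
    fix A B D E f g h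
    assume A: "A \<in> ob (Cls Q)" and f: "f \<in> mor (Cls Q) A B"
    have "f \<in> qfunctors Q (fst A) (fst B)" using f cont A by blast
    from functor_closed[OF this] show "compose (carrier (fst A)) (compose (carrier (fst B)) h g) f =
        compose (carrier (fst A)) h (compose (carrier (fst A)) g f)"
      by (intro ext) (simp add: compose_def)
  next
    fix A B f g h
    assume A: "A \<in> ob (Cls Q)" and B: "B \<in> ob (Cls Q)"
      and f: "f \<in> mor (Cls Q) A B" and g: "g \<in> mor (Cls Q) A B" and h: "h \<in> mor (Cls Q) A B"
      and fg: "fun_le Q (fst A) (fst B) f g" and gh: "fun_le Q (fst A) (fst B) g h"
    have fgh: "f \<in> qfunctors Q (fst A) (fst B)" "g \<in> qfunctors Q (fst A) (fst B)" "h \<in> qfunctors Q (fst A) (fst B)"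
      using f g h cont A by blast+
    show "fun_le Q (fst A) (fst B) f h"
      unfolding fun_le_def
    proof
      fix x assume x: "x \<in> carrier (fst A)"
      show "cat_le Q (fst B) (f x) (h x)"
        using cat_le_trans[OF cls(1)[OF B] fgh[THEN functor_closed, OF x]] fg gh x
        unfolding fun_le_def by blast
    qed
  next
    fix A B D f f' g g'
    assume A: "A \<in> ob (Cls Q)" and B: "B \<in> ob (Cls Q)" and D: "D \<in> ob (Cls Q)"
      and f: "f \<in> mor (Cls Q) A B" and f': "f' \<in> mor (Cls Q) A B"
      and g: "g \<in> mor (Cls Q) B D" and g': "g' \<in> mor (Cls Q) B D"
      and le_f: "fun_le Q (fst A) (fst B) f f'" and le_g: "fun_le Q (fst B) (fst D) g g'"
    have F: "f \<in> qfunctors Q (fst A) (fst B)" "f' \<in> qfunctors Q (fst A) (fst B)"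
      "g \<in> qfunctors Q (fst B) (fst D)" "g' \<in> qfunctors Q (fst B) (fst D)"
      using f f' g g' cont A B by blast+
    note Y = cls(1)[OF B] and Z = cls(1)[OF D]
    have "cat_le Q (fst D) (g (f x)) (g' (f' x))" if x: "x \<in> carrier (fst A)" for x
    proof -
      note fx = functor_closed[OF F(1) x] and f'x = functor_closed[OF F(2) x]
      have "cat_le Q (fst D) (g (f x)) (g (f' x))"
        using functor_mono[OF Y Z F(3) fx f'x] le_f x unfolding fun_le_def by blast
      moreover have "cat_le Q (fst D) (g (f' x)) (g' (f' x))"
        using le_g f'x unfolding fun_le_def by blast
      ultimately show ?thesis
        using cat_le_trans[OF Z functor_closed[OF F(3) fx] functor_closed[OF F(3) f'x]
            functor_closed[OF F(4) f'x]] by blast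
    qed
    then show "fun_le Q (fst A) (fst D) (compose (carrier (fst A)) g f) (compose (carrier (fst A)) g' f')"
      unfolding fun_le_def by (simp add: compose_eq)
  qed
qed

lemma Alg_eq_Cls: "Alg Q (yoneda_sup_law Q) = Cls Q"
proof -
  have "lax_homs Q = continuous_functors Q"
    unfolding lax_homs_def continuous_functors_def ..
  then show ?thesis
    unfolding Alg_def Cls_def lax_algebra_eq_closure_space by simp
qed

end

lemma isomorphic_two_categories_refl:
  assumes "two_category C"
  shows "isomorphic_two_categories C C"
proof -
  have "two_functor C C (\<lambda>A. A) (\<lambda>A B f. f)"
    unfolding two_functor_def by blast
  moreover have "inverse_functors C (\<lambda>A. A) (\<lambda>A B f. f) (\<lambda>A. A) (\<lambda>A B f. f)"
    unfolding inverse_functors_def by blast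
  ultimately show ?thesis
    unfolding isomorphic_two_categories_def using assms by blast
qed

theorem theorem5p2:
  fixes Q :: "('o, 'a) quantaloid"
  assumes "quantaloid Q"
  shows "distributive_law Q
           (yoneda_sup_law Q :: ('o, 'a, 'x) law)
           (yoneda_sup_law Q :: ('o, 'a, 'y) law)
           (yoneda_sup_law Q :: ('o, 'a, ('o, 'a, 'x) presheaf) law) \<and>
         flat_law Q (yoneda_sup_law Q :: ('o, 'a, 'x) law) \<and>
         isomorphic_two_categories
           (Alg Q (yoneda_sup_law Q :: ('o, 'a, 'x) law))
           (Cls Q :: (('o, 'a, 'x) space, 'x \<Rightarrow> 'x) twocat)"
proof -
  interpret quantaloid_calculus Q
    using assms by unfold_locales
  show ?thesis
    unfolding Alg_eq_Cls
    using distributive_yoneda_sup_law flat_yoneda_sup_law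
      isomorphic_two_categories_refl[OF two_category_Cls] by blast
qed

end
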